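(* For every integer $n\ge 0$, $$ \det \left[ \binom{3 (i +j) +1}{i+j} \right]_{0 \leq i,j \leq n} = (-1)^n \prod_{i=1}^n \frac{ (6i-3)!\,(3i+2)!\,(2i-1)!} {(4i-1)!\,(4i+1)!\,(3i-2)!} \;\sum_{i=0}^n\frac{n!\,(3n+i+2)!\, (-6)^i} {(3n+2)!\, (n-i)!\, (2i+1)!} $$ and $$ \det \left[ \binom{3 (i +j) +2}{i+j} \right]_{0 \leq i,j \leq n} = (-1)^n \prod_{i=1}^n \frac{ (6i-3)!\,(3i+2)!\,(2i-1)!} {(4i-1)!\,(4i+1)!\,(3i-2)!} \;\sum_{i=0}^n\frac{n!\,(3n+i+2)!\, (-4)^i} {(3n+2)!\, (n-i)!\, (2i+1)!}. $$
   Context: Empty products equal $1$. *)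

theory Defs
  imports "Jordan_Normal_Form.Determinant"
begin

end

theory Submission
  imports Defs "HOL-Computational_Algebra.Computational_Algebra"
begin

text \<open>Write the two Hankel matrices as \<open>binom (3 (i + j) + r) (i + j)\<close> with \<open>r = 1, 2\<close>. The proof
has four steps.

First, both matrices are congruent, through unit lower triangular matrices of binomial coefficients,
to coefficient matrices of one sparse kernel
\<open>K\<^sub>c(X, V) = (1 + c X V) / (1 - 3 X V - X V (X + V))\<close>,
with \<open>c = 2\<close> for \<open>r = 1\<close> and \<open>c = 0\<close> for \<open>r = 2\<close> (\<open>det_hankel_eq_det_kernel\<close>). The reason is that
\<open>(1 + X)^3 / X - (1 + Z)^3 / Z\<close> is, up to sign and a monomial, \<open>X - Z\<close> times the denominator of the kernel, so
the congruent matrix depends on \<open>i + j\<close> only. Let \<open>D\<^sub>n(c)\<close> be the kernel determinant of size \<open>n + 1\<close>,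
and let \<open>h\<^sub>j(X)\<close> be the coefficient of \<open>V^j\<close> in \<open>K\<^sub>0\<close>.

Second, unimodular row and column operations turn the columns of \<open>D\<^sub>n(c)\<close> into \<open>h\<^sub>0, ..., h\<^sub>n\<^sub>-\<^sub>1\<close> and
\<open>\<Sum>\<^sub>k c^k h\<^sub>n\<^sub>+\<^sub>k\<close>. Hence, if a linear functional \<open>L\<close> on power series modulo \<open>X^(n + 1)\<close> satisfies
\<open>L(X^n) = 1\<close> and \<open>L(h\<^sub>j) = 0\<close> for \<open>j < n\<close>, then \<open>D\<^sub>n(c) = D\<^sub>n\<^sub>-\<^sub>1(0) \<Sum>\<^sub>k c^k L(h\<^sub>n\<^sub>+\<^sub>k)\<close>
(\<open>det_kernel_functional\<close>).

Third, such an \<open>L\<close> is a residue (\<open>exists_kernel_functional\<close>). Put \<open>\<alpha> = u (1 + u)\<close> and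
\<open>Y = u^2 / (1 + u)\<close>; then \<open>\<alpha>^2 = (3 Y + Y^2) \<alpha> + Y\<close>, which gives
\<open>\<alpha>^(j + 1) = h\<^sub>j(Y) \<alpha> + Y h\<^sub>j\<^sub>-\<^sub>1(Y)\<close>. Take \<open>L(f) = Res f(Y) \<alpha> \<eta>\<close> at \<open>u = 0\<close>, where
\<open>\<eta> = \<psi>(\<alpha>) d\<alpha> / \<alpha>^(2 n + 2)\<close> for a polynomial \<open>\<psi>\<close> of degree \<open>n\<close>. If \<open>Y^m \<eta>\<close> has no residue for
\<open>m \<ge> 1\<close>, then \<open>L(h\<^sub>j) = Res \<alpha>^(j + 1) \<eta>\<close> is the coefficient of \<open>\<psi>\<close> at \<open>2 n - j\<close>. The residues vanish
when \<open>\<eta>\<close> is odd, up to a holomorphic form, under the involution \<open>u \<mapsto> - u / (1 + u)\<close>, which fixes \<open>Y\<close>.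
This happens for the Jacobi polynomial \<open>\<psi>(\<alpha>) = 2F1(- n, - 3 n - 3/2; - 4 n - 2; - 4 \<alpha>)\<close>: its
parameters admit a quadratic transformation, so \<open>(1 + 2 u) \<psi>(u + u^2)\<close> is the hypergeometric polynomial
\<open>2F1(- 2 n - 1, - 6 n - 4; - 4 n - 2; - u)\<close>, and the oddness is the Pfaff transformation of the latter
(\<open>psi_lift_nth\<close>, \<open>psi_lift_pfaff\<close>, \<open>psi_lift_residue\<close>).

Finally, \<open>D\<^sub>n(c) = D\<^sub>n\<^sub>-\<^sub>1(0) \<Sum>\<^sub>k c^k \<psi>\<^sub>n\<^sub>-\<^sub>k\<close>, where the case \<open>c = 0\<close> evaluates \<open>D\<^sub>n(0)\<close> as a product.
The sums in the theorem are Jacobi sums in powers of \<open>z = - 4 - c\<close>; re-expanding them at \<open>c = 0\<close> by means of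
the hypergeometric equation gives the coefficients \<open>\<psi>\<^sub>n\<^sub>-\<^sub>k\<close> (\<open>sum_coeff_shift\<close>).\<close>

section \<open>Reduction of the Hankel matrices to a sparse kernel\<close>

unbundle fps_syntax
no_notation vec_index (infixl "$" 100)

text \<open>\<open>kernel_col c j\<close> is the coefficient of \<open>V^j\<close>, a power series in \<open>X\<close>, of the kernel
\<open>(1 + c X V) / (1 - 3 X V - X V (X + V))\<close>. Series in \<open>X\<close> have type \<^typ>\<open>rat fps\<close>, and series in \<open>V\<close>
over them have type \<^typ>\<open>rat fps fps\<close>; in the latter \<open>fps_X\<close> is \<open>V\<close> and \<open>fps_const fps_X\<close> is \<open>X\<close>.\<close>

fun kernel_col :: "rat \<Rightarrow> nat \<Rightarrow> rat fps" where
  "kernel_col c 0 = 1"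
| "kernel_col c (Suc 0) = 3 * fps_X + fps_X ^ 2 + fps_const c * fps_X"
| "kernel_col c (Suc (Suc j)) = (3 * fps_X + fps_X ^ 2) * kernel_col c (Suc j) + fps_X * kernel_col c j"

lemma kernel_col_Suc: "kernel_col c (Suc j) = kernel_col 0 (Suc j) + fps_const c * fps_X * kernel_col 0 j"
proof (induction j rule: induct_nat_012)
  case (ge2 i)
  have "kernel_col c (Suc (Suc (Suc i)))
      = (3 * fps_X + fps_X ^ 2) * (kernel_col 0 (Suc (Suc i)) + fps_const c * fps_X * kernel_col 0 (Suc i))
        + fps_X * (kernel_col 0 (Suc i) + fps_const c * fps_X * kernel_col 0 i)"
    by (simp only: kernel_col.simps(3)[of c "Suc i"] ge2)
  also have "\<dots> = ((3 * fps_X + fps_X ^ 2) * kernel_col 0 (Suc (Suc i)) + fps_X * kernel_col 0 (Suc i))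
      + fps_const c * fps_X * ((3 * fps_X + fps_X ^ 2) * kernel_col 0 (Suc i) + fps_X * kernel_col 0 i)"
    by (simp only: algebra_simps)
  finally show ?case
    by (simp only: kernel_col.simps(3))
qed (simp_all add: algebra_simps)

text \<open>The denominator \<open>1 - 3 X V - X V (X + V)\<close> of the kernel, as a series in \<open>V\<close>.\<close>

definition kernel_denom :: "rat fps fps" where
  "kernel_denom = 1 - fps_const (3 * fps_X + fps_X ^ 2) * fps_X - fps_const fps_X * fps_X ^ 2"

lemma kernel_mult_denom:
  "Abs_fps (kernel_col c) * kernel_denom = 1 + fps_const (fps_const c * fps_X) * fps_X"
proof (rule fps_ext)
  fix m
  have *: "(Abs_fps (kernel_col c) * kernel_denom) $ m = kernel_col c m
     - (3 * fps_X + fps_X ^ 2) * (if m = 0 then 0 else kernel_col c (m - 1))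
     - fps_X * (if m < 2 then 0 else kernel_col c (m - 2))"
    by (simp add: kernel_denom_def right_diff_distrib fps_X_power_mult_right_nth mult.commute[of "fps_const a" for a]
      flip: mult.assoc)
  show "(Abs_fps (kernel_col c) * kernel_denom) $ m = (1 + fps_const (fps_const c * fps_X) * fps_X) $ m"
  proof -
    consider "m = 0" | "m = Suc 0" | i where "m = Suc (Suc i)"
      using not0_implies_Suc by blast
    then show ?thesis
      unfolding * by cases (auto simp: algebra_simps)
  qed
qed

lemma cubic_factorization:
  "fps_const ((1 + fps_X) ^ 3) * fps_X - fps_const fps_X * (1 + fps_X) ^ 3
     = (fps_X - fps_const fps_X) * kernel_denom"
  unfolding kernel_denom_def
  by (simp add: algebra_simps power2_eq_square power3_eq_cube flip: fps_const_add fps_const_mult)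

lemma one_plus_X_power_nth: "((1 + fps_X) ^ m :: 'a :: comm_ring_1 fps) $ k = of_nat (m choose k)"
proof (induction m arbitrary: k)
  case 0
  then show ?case by (cases k) auto
next
  case (Suc m)
  then show ?case by (cases k) (auto simp: distrib_right)
qed

text \<open>The coefficient of \<open>V^j\<close> in \<open>(1 + V)^(3 j + r) K\<^sub>c(X, V)\<close>: the kernel multiplied on the right by the
transpose of the unit lower triangular matrix \<open>binom (3 j + r) (j - k)\<close>.\<close>

definition kernel_row :: "nat \<Rightarrow> rat \<Rightarrow> nat \<Rightarrow> rat fps" where
  "kernel_row r c j = ((1 + fps_X) ^ (3 * j + r) * Abs_fps (kernel_col c)) $ j"

lemma Suc_times_choose_Suc: "Suc k * (m choose Suc k) = (m - k) * (m choose k)"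
  by (simp only: binomial_absorption binomial_absorb_comp)

text \<open>These relations, for \<open>r = 2\<close> with \<open>c = 0\<close> and for \<open>r = 1\<close> with \<open>c = 2\<close>, make the coefficients in
\<open>kernel_row_step\<close> multiples of \<open>binom (3 j + r) j\<close>.\<close>

lemma choose_relations:
  shows "(3 * j + 2) choose Suc j = 2 * ((3 * j + 2) choose j)"
    and "of_nat ((3 * j + 1) choose Suc j) - 2 * (if j = 0 then 0 else of_nat ((3 * j + 1) choose (j - 1)))
      = (of_nat ((3 * j + 1) choose j) :: rat)"
proof -
  have "Suc j * ((3 * j + 2) choose Suc j) = Suc j * (2 * ((3 * j + 2) choose j))"
    using Suc_times_choose_Suc[of j "3 * j + 2"] by simp
  then show "(3 * j + 2) choose Suc j = 2 * ((3 * j + 2) choose j)"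
    by (metis mult_cancel1 nat.distinct(1))
  define a b d where "a = (of_nat ((3 * j + 1) choose j) :: rat)"
    and "b = (of_nat ((3 * j + 1) choose Suc j) :: rat)"
    and "d = (if j = 0 then 0 else of_nat ((3 * j + 1) choose (j - 1)) :: rat)"
  have "Suc j * ((3 * j + 1) choose Suc j) = (2 * j + 1) * ((3 * j + 1) choose j)"
    using Suc_times_choose_Suc[of j "3 * j + 1"] by simp
  from arg_cong[OF this, of "of_nat :: nat \<Rightarrow> rat"]
  have b: "(of_nat j + 1) * b = (2 * of_nat j + 1) * a"
    unfolding a_def b_def by (simp only: of_nat_mult of_nat_add of_nat_Suc of_nat_1 of_nat_numeral add_ac)
  have d: "of_nat j * a = (2 * of_nat j + 2) * d"
  proof (cases j)
    case (Suc i)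
    have "j * ((3 * j + 1) choose j) = (2 * j + 2) * ((3 * j + 1) choose i)"
      using Suc_times_choose_Suc[of i "3 * j + 1"] Suc by (simp add: distrib_right)
    from arg_cong[OF this, of "of_nat :: nat \<Rightarrow> rat"]
    show ?thesis
      unfolding a_def d_def using Suc by (simp add: algebra_simps)
  qed (simp add: d_def)
  have "(of_nat j + 1) * (b - 2 * d) = (of_nat j + 1) * a"
    using b d by (simp add: algebra_simps)
  then have "b - 2 * d = a"
    by (metis mult_cancel_left of_nat_neq_0 of_nat_Suc add.commute)
  then show "of_nat ((3 * j + 1) choose Suc j) - 2 * (if j = 0 then 0 else of_nat ((3 * j + 1) choose (j - 1)))
      = (of_nat ((3 * j + 1) choose j) :: rat)"
    unfolding a_def b_def d_def by simp
qed

lemma kernel_row_step: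
  assumes "(r = 2 \<and> c = 0) \<or> (r = 1 \<and> c = 2)"
  shows "(1 + fps_X) ^ 3 * kernel_row r c j - fps_X * kernel_row r c (Suc j)
    = fps_const (of_nat ((3 * j + r) choose j)) * ((1 - 2 * fps_X) * (1 + fps_X) ^ (2 - r))"
proof -
  let ?B = "(1 + fps_X) ^ (3 * j + r) :: rat fps fps" and ?K = "Abs_fps (kernel_col c)"
  have "(1 + fps_X) ^ 3 * kernel_row r c j - fps_X * kernel_row r c (Suc j)
      = (?B * ?K * (fps_const ((1 + fps_X) ^ 3) * fps_X - fps_const fps_X * (1 + fps_X) ^ 3)) $ Suc j"
  proof -
    have *: "?B * ?K * (fps_const ((1 + fps_X) ^ 3) * fps_X - fps_const fps_X * (1 + fps_X) ^ 3)
        = fps_const ((1 + fps_X) ^ 3) * (?B * ?K) * fps_X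
          - fps_const fps_X * ((1 + fps_X) ^ (3 * Suc j + r) * ?K)"
      by (simp add: power_add algebra_simps power3_eq_cube)
    show ?thesis
      unfolding * by (simp add: kernel_row_def)
  qed
  also have "\<dots> = (?B * (fps_X - fps_const fps_X) * (?K * kernel_denom)) $ Suc j"
    unfolding cubic_factorization by (simp only: mult_ac)
  also have "\<dots> = (?B * (fps_X - fps_const fps_X + fps_const (fps_const c * fps_X) * fps_X ^ 2 -
      fps_const (fps_const c * fps_X ^ 2) * fps_X)) $ Suc j"
    unfolding kernel_mult_denom
    by (rule arg_cong[where f = "\<lambda>f. f $ Suc j"])
      (simp add: algebra_simps power2_eq_square flip: fps_const_mult)
  also have "\<dots> = of_nat ((3 * j + r) choose j) - fps_X * of_nat ((3 * j + r) choose Suc j)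
     + fps_const c * fps_X * (if j = 0 then 0 else of_nat ((3 * j + r) choose (j - 1)))
     - fps_const c * fps_X ^ 2 * of_nat ((3 * j + r) choose j)"
    by (simp add: right_diff_distrib distrib_left fps_X_power_mult_right_nth one_plus_X_power_nth
        mult.commute[of "fps_const a" for a] flip: mult.assoc)
  also have "\<dots> = fps_const (of_nat ((3 * j + r) choose j)) * ((1 - 2 * fps_X) * (1 + fps_X) ^ (2 - r))"
  proof -
    define a b d where "a = (of_nat ((3 * j + r) choose j) :: rat)"
      and "b = (of_nat ((3 * j + r) choose Suc j) :: rat)"
      and "d = (if j = 0 then 0 else of_nat ((3 * j + r) choose (j - 1)) :: rat)"
    have "of_nat ((3 * j + r) choose j) - fps_X * of_nat ((3 * j + r) choose Suc j)
       + fps_const c * fps_X * (if j = 0 then 0 else of_nat ((3 * j + r) choose (j - 1)))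
       - fps_const c * fps_X ^ 2 * of_nat ((3 * j + r) choose j)
       = fps_const a - fps_X * fps_const b + fps_const c * fps_X * fps_const d
          - fps_const c * fps_X ^ 2 * fps_const a"
      by (simp add: a_def b_def d_def fps_of_nat)
    also have "\<dots> = fps_const a - fps_const (b - c * d) * fps_X
       - fps_const (c * a) * fps_X ^ 2"
      by (simp add: algebra_simps flip: fps_const_mult fps_const_sub)
    also have "\<dots> = fps_const a * ((1 - 2 * fps_X) * (1 + fps_X) ^ (2 - r))"
      using assms
    proof (elim disjE conjE)
      assume "r = 2" "c = 0"
      moreover from this have "b = 2 * a"
        unfolding a_def b_def by (simp only: choose_relations(1) of_nat_mult of_nat_numeral)
      ultimately show ?thesis
        by (simp add: algebra_simps numeral_fps_const)
    next
      assume "r = 1" "c = 2"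
      moreover from this have "b - c * d = a"
        unfolding a_def b_def d_def by (simp only: choose_relations(2))
      ultimately show ?thesis
        by (simp add: algebra_simps power2_eq_square numeral_fps_const flip: fps_const_mult)
    qed
    finally show ?thesis
      unfolding a_def .
  qed
  finally show ?thesis .
qed

lemma kernel_row_0: "kernel_row r c 0 = 1"
  by (simp add: kernel_row_def fps_power_zeroth)

text \<open>By \<open>kernel_row_step\<close> the left-hand side does not change when \<open>(i, j + 1)\<close> is replaced by
\<open>(i + 1, j)\<close>, because the coefficient of \<open>X^(i + 1)\<close> in \<open>(1 + X)^(3 i + 2) (1 - 2 X)\<close> is zero; so
it is determined by its value at \<open>j = 0\<close>.\<close>

lemma binomial_eq_kernel_row_coeff:
  assumes "(r = 2 \<and> c = 0) \<or> (r = 1 \<and> c = 2)"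
  shows "((1 + fps_X) ^ (3 * i + r) * kernel_row r c j) $ i = of_nat ((3 * (i + j) + r) choose (i + j))"
proof (induction j arbitrary: i)
  case 0
  show ?case by (simp add: kernel_row_0 one_plus_X_power_nth)
next
  case (Suc j)
  have "((1 + fps_X) ^ (3 * Suc i + r) * kernel_row r c j) $ Suc i
      - ((1 + fps_X) ^ (3 * i + r) * kernel_row r c (Suc j)) $ i
     = ((1 + fps_X) ^ (3 * i + r) * ((1 + fps_X) ^ 3 * kernel_row r c j - fps_X * kernel_row r c (Suc j))) $ Suc i"
  proof -
    have "(1 + fps_X :: rat fps) ^ (3 * Suc i + r) = (1 + fps_X) ^ (3 * i + r) * (1 + fps_X) ^ 3"
      by (simp add: add_ac flip: power_add)
    moreover have "B * (A * p - fps_X * q) = B * A * p - fps_X * (B * q)" for A B p q :: "rat fps"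
      by (simp only: right_diff_distrib mult_ac)
    ultimately show ?thesis
      by (simp only: fps_sub_nth fps_X_mult_nth nat.distinct if_False diff_Suc_1)
  qed
  also have "\<dots> = of_nat ((3 * j + r) choose j) * ((1 + fps_X) ^ (3 * i + 2) * (1 - 2 * fps_X)) $ Suc i"
  proof -
    have "r + (2 - r) = 2"
      using assms by auto
    then have *: "(1 + fps_X :: rat fps) ^ (3 * i + r) * (1 + fps_X) ^ (2 - r) = (1 + fps_X) ^ (3 * i + 2)"
      by (simp add: add.assoc flip: power_add)
    have "B * (fps_const a * (p * q)) = fps_const a * (B * q * p)" for a and B p q :: "rat fps"
      by (simp only: mult_ac)
    then show ?thesis
      by (simp only: kernel_row_step[OF assms] * fps_mult_left_const_nth)
  qed
  also have "\<dots> = 0"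
  proof -
    have "((1 + fps_X) ^ (3 * i + 2) * (1 - 2 * fps_X)) $ Suc i
        = (of_nat ((3 * i + 2) choose Suc i) - 2 * of_nat ((3 * i + 2) choose i) :: rat)"
    proof -
      have "B * (1 - 2 * fps_X) = B - fps_const 2 * (B * fps_X)" for B :: "rat fps"
        by (simp add: algebra_simps numeral_fps_const)
      then show ?thesis
        by (simp only: fps_sub_nth fps_mult_left_const_nth fps_X_mult_right_nth one_plus_X_power_nth) simp
    qed
    then show ?thesis
      by (simp only: choose_relations(1) of_nat_mult of_nat_numeral) simp
  qed
  finally show ?case using Suc.IH[of "Suc i"] by simp
qed

section \<open>Evaluation of the kernel determinant by a linear functional\<close>

lemma det_unit_lower:
  fixes l :: "nat \<Rightarrow> nat \<Rightarrow> 'a :: comm_ring_1"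
  assumes "\<And>i. i < n \<Longrightarrow> l i i = 1" "\<And>i j. i < j \<Longrightarrow> j < n \<Longrightarrow> l i j = 0"
  shows "det (mat n n (\<lambda>(i, j). l i j)) = 1"
proof -
  have "det (mat n n (\<lambda>(i, j). l i j)) = prod_list (diag_mat (mat n n (\<lambda>(i, j). l i j)))"
    by (rule det_lower_triangular[of n]) (auto simp: assms)
  then show ?thesis
    by (simp add: prod_list_diag_prod assms)
qed

lemma det_mat_swap:
  fixes f :: "nat \<Rightarrow> nat \<Rightarrow> 'a :: comm_ring_1"
  shows "det (mat n n (\<lambda>(i, j). f j i)) = det (mat n n (\<lambda>(i, j). f i j))"
proof -
  have "mat n n (\<lambda>(i, j). f j i) = transpose_mat (mat n n (\<lambda>(i, j). f i j))"
    by (rule eq_matI) auto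
  then show ?thesis
    by (simp add: det_transpose[of _ n])
qed

lemma det_mat_sum:
  fixes l f :: "nat \<Rightarrow> nat \<Rightarrow> 'a :: comm_ring_1"
  shows "det (mat n n (\<lambda>(i, j). \<Sum>k<n. l i k * f k j))
       = det (mat n n (\<lambda>(i, j). l i j)) * det (mat n n (\<lambda>(i, j). f i j))"
proof -
  have "mat n n (\<lambda>(i, j). \<Sum>k<n. l i k * f k j)
      = mat n n (\<lambda>(i, j). l i j) * mat n n (\<lambda>(i, j). f i j)"
    by (rule eq_matI) (auto simp: scalar_prod_def atLeast0LessThan)
  then show ?thesis
    by (simp add: det_mult[of _ n])
qed

lemma det_unit_lower_mult:
  fixes l f :: "nat \<Rightarrow> nat \<Rightarrow> 'a :: comm_ring_1"
  assumes "\<And>i. i < n \<Longrightarrow> l i i = 1" "\<And>i j. i < j \<Longrightarrow> j < n \<Longrightarrow> l i j = 0"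
  shows "det (mat n n (\<lambda>(i, j). \<Sum>k<n. l i k * f k j)) = det (mat n n (\<lambda>(i, j). f i j))"
  by (simp add: det_mat_sum det_unit_lower[OF assms])

lemma det_hankel_eq_det_kernel:
  assumes "(r = 2 \<and> c = 0) \<or> (r = 1 \<and> c = 2)"
  shows "det (mat n n (\<lambda>(i, j). of_nat ((3 * (i + j) + r) choose (i + j)) :: rat))
       = det (mat n n (\<lambda>(i, j). kernel_col c j $ i))"
proof -
  define l where "l i k = (if k \<le> i then of_nat ((3 * i + r) choose (i - k)) else 0 :: rat)" for i k
  have l: "l i i = 1" "i < k \<Longrightarrow> l i k = 0" for i k
    by (simp_all add: l_def)
  have row: "((1 + fps_X) ^ (3 * i + r) * f) $ i = (\<Sum>k<n. l i k * f $ k)"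
    if "i < n" for f :: "rat fps" and i
  proof -
    have "((1 + fps_X) ^ (3 * i + r) * f) $ i = (\<Sum>k=0..i. l i k * f $ k)"
      by (simp add: mult.commute[of _ f] fps_mult_nth one_plus_X_power_nth l_def mult.commute)
    also have "\<dots> = (\<Sum>k<n. l i k * f $ k)"
      using that by (intro sum.mono_neutral_left) (auto simp: l_def)
    finally show ?thesis .
  qed
  have col: "kernel_row r c j $ k = (\<Sum>i<n. l j i * kernel_col c i $ k)" if "j < n" for j k
  proof -
    have "kernel_row r c j = (\<Sum>i=0..j. of_nat ((3 * j + r) choose (j - i)) * kernel_col c i)"
      by (simp add: kernel_row_def mult.commute[of _ "Abs_fps (kernel_col c)"] fps_mult_nth one_plus_X_power_nth
          mult.commute)
    then have "kernel_row r c j $ k = (\<Sum>i=0..j. l j i * kernel_col c i $ k)"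
      by (simp add: fps_sum_nth l_def flip: fps_of_nat)
    also have "\<dots> = (\<Sum>i<n. l j i * kernel_col c i $ k)"
      using that by (intro sum.mono_neutral_left) (auto simp: l_def)
    finally show ?thesis .
  qed
  have "mat n n (\<lambda>(i, j). of_nat ((3 * (i + j) + r) choose (i + j)) :: rat)
      = mat n n (\<lambda>(i, j). \<Sum>k<n. l i k * kernel_row r c j $ k)"
    by (rule eq_matI) (simp_all only: index_mat dim_row_mat dim_col_mat split binomial_eq_kernel_row_coeff[OF assms, symmetric] row)
  then have "det (mat n n (\<lambda>(i, j). of_nat ((3 * (i + j) + r) choose (i + j)) :: rat))
      = det (mat n n (\<lambda>(k, j). kernel_row r c j $ k))"
    by (simp add: det_unit_lower_mult[of n l, OF l])
  also have "\<dots> = det (mat n n (\<lambda>(j, k). \<Sum>i<n. l j i * kernel_col c i $ k))"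
    by (subst det_mat_swap[symmetric]) (auto intro!: arg_cong[where f = det] eq_matI simp: col)
  also have "\<dots> = det (mat n n (\<lambda>(i, j). kernel_col c j $ i))"
    by (rule trans[OF det_unit_lower_mult[of n l, OF l] det_mat_swap[symmetric]])
  finally show ?thesis .
qed

lemma kernel_col_nth_eq_0: "2 * i < j \<Longrightarrow> kernel_col c j $ i = 0"
proof (induction j arbitrary: i rule: induct_nat_012)
  case (ge2 j)
  have "kernel_col c (Suc (Suc j)) = fps_X * (3 * kernel_col c (Suc j) + fps_X * kernel_col c (Suc j) + kernel_col c j)"
    by (simp add: algebra_simps power2_eq_square)
  moreover have "(3 * kernel_col c (Suc j) + fps_X * kernel_col c (Suc j) + kernel_col c j) $ (i - 1) = 0" if "i > 0"
  proof -
    have "kernel_col c (Suc j) $ (i - 1) = 0" "kernel_col c j $ (i - 1) = 0"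
      using that ge2 by auto
    moreover have "(fps_X * kernel_col c (Suc j)) $ (i - 1) = 0"
      using that ge2 by auto
    moreover have "(3 * kernel_col c (Suc j)) $ (i - 1) = 3 * kernel_col c (Suc j) $ (i - 1)"
      unfolding numeral_fps_const by (rule fps_mult_left_const_nth)
    ultimately show ?thesis
      by simp
  qed
  ultimately show ?case
    by (simp only: fps_X_mult_nth) simp
qed (auto simp: numeral_fps_const)

text \<open>The factor on the right does not depend on \<open>j\<close>; it is the denominator of the kernel at \<open>V = c\<close>. Dividing
by it turns this combination of neighbouring columns into a column of the kernel with numerator \<open>1\<close>.\<close>

lemma kernel_col_diff:
  "kernel_col c j - fps_const c * kernel_col c (Suc j)
    = kernel_col 0 j * (1 - fps_const c * (3 * fps_X + fps_X ^ 2) - fps_const c ^ 2 * fps_X)"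
proof (cases j)
  case (Suc i)
  show ?thesis
    unfolding Suc kernel_col_Suc[of c i] kernel_col_Suc[of c "Suc i"] kernel_col.simps(3)[of 0 i]
    by (simp add: algebra_simps power2_eq_square)
qed (simp add: algebra_simps power2_eq_square)

text \<open>A functional on power series modulo \<open>X^(n + 1)\<close> is given by its values \<open>w m\<close> on the powers \<open>X^m\<close>.\<close>

lemma det_kernel_functional:
  fixes w :: "nat \<Rightarrow> rat" and n :: nat
  defines "L \<equiv> \<lambda>f :: rat fps. \<Sum>m\<le>n. w m * f $ m"
  assumes "w n = 1" and "\<And>j. j < n \<Longrightarrow> L (kernel_col 0 j) = 0"
  shows "det (mat (n + 1) (n + 1) (\<lambda>(i, j). kernel_col c j $ i))
       = det (mat n n (\<lambda>(i, j). kernel_col 0 j $ i)) * (\<Sum>k\<le>n. c ^ k * L (kernel_col 0 (n + k)))"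
proof -
  define q where "q = 1 - fps_const c * (3 * fps_X + fps_X ^ 2) - fps_const c ^ 2 * fps_X"
  define E where "E = inverse q"
  have "q $ 0 = 1"
    by (simp add: q_def)
  then have Eq: "q * E = 1" and E0: "E $ 0 = 1"
    by (simp_all add: E_def inverse_mult_eq_1')
  have E_diff: "E * kernel_col c j = kernel_col 0 j + fps_const c * (E * kernel_col c (Suc j))" for j
  proof -
    have "E * (kernel_col c j - fps_const c * kernel_col c (Suc j)) = (q * E) * kernel_col 0 j"
      unfolding kernel_col_diff q_def by (simp only: mult_ac)
    then show ?thesis
      unfolding Eq by (simp add: algebra_simps)
  qed
  \<comment> \<open>Column operations: \<open>f j\<close> are the new columns and \<open>r\<close> is the matrix of the operation.\<close>
  define f where "f j = (if j < n then kernel_col c j - fps_const c * kernel_col c (Suc j) else kernel_col c n)" for j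
  define r where "r j k = (if k = j then 1 else if k = Suc j then - c else 0)" for j k :: nat
  have "det (mat (n + 1) (n + 1) (\<lambda>(i, j). kernel_col c j $ i))
      = det (mat (n + 1) (n + 1) (\<lambda>(i, j). f j $ i))"
  proof -
    have "f j = (\<Sum>k<n + 1. fps_const (r j k) * kernel_col c k)" if "j < n + 1" for j
    proof -
      have "(\<Sum>k<n + 1. fps_const (r j k) * kernel_col c k)
          = (\<Sum>k\<in>(if j < n then {j, Suc j} else {j}). fps_const (r j k) * kernel_col c k)"
        using that by (intro sum.mono_neutral_right) (auto simp: r_def)
      then show ?thesis
        using that by (auto simp: f_def r_def less_Suc_eq fps_const_neg[symmetric] simp del: fps_const_neg)
    qed
    then have "mat (n + 1) (n + 1) (\<lambda>(j, i). f j $ i)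
        = mat (n + 1) (n + 1) (\<lambda>(j, i). \<Sum>k<n + 1. r j k * kernel_col c k $ i)"
      by (intro eq_matI)
        (simp_all only: index_mat dim_row_mat dim_col_mat split fps_sum_nth fps_mult_left_const_nth)
    then have "det (mat (n + 1) (n + 1) (\<lambda>(j, i). f j $ i))
        = det (mat (n + 1) (n + 1) (\<lambda>(j, k). r k j)) * det (mat (n + 1) (n + 1) (\<lambda>(k, i). kernel_col c k $ i))"
      by (simp only: det_mat_sum det_mat_swap[of "n + 1" r])
    also have "det (mat (n + 1) (n + 1) (\<lambda>(j, k). r k j)) = 1"
      by (rule det_unit_lower) (auto simp: r_def)
    finally have "det (mat (n + 1) (n + 1) (\<lambda>(k, i). kernel_col c k $ i))
        = det (mat (n + 1) (n + 1) (\<lambda>(j, i). f j $ i))"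
      by (simp only: mult_1)
    from trans[OF trans[OF det_mat_swap this] det_mat_swap[symmetric]] show ?thesis .
  qed
  also have "\<dots> = det (mat (n + 1) (n + 1) (\<lambda>(i, j). (E * f j) $ i))"
  proof -
    \<comment> \<open>Multiplication by the unit \<open>E\<close> is a unit lower triangular Toeplitz matrix.\<close>
    define l where "l i k = (if k \<le> i then E $ (i - k) else 0)" for i k
    have "(E * f j) $ i = (\<Sum>k<n + 1. l i k * f j $ k)" if "i < n + 1" for i j
    proof -
      have "(E * f j) $ i = (\<Sum>k=0..i. l i k * f j $ k)"
        unfolding mult.commute[of E] fps_mult_nth by (intro sum.cong) (simp_all add: l_def mult.commute)
      also have "\<dots> = (\<Sum>k<n + 1. l i k * f j $ k)"
        using that by (intro sum.mono_neutral_left) (auto simp: l_def)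
      finally show ?thesis .
    qed
    then have "mat (n + 1) (n + 1) (\<lambda>(i, j). (E * f j) $ i)
        = mat (n + 1) (n + 1) (\<lambda>(i, j). \<Sum>k<n + 1. l i k * f j $ k)"
      by (intro eq_matI) (simp_all only: index_mat dim_row_mat dim_col_mat split)
    also have "det \<dots> = det (mat (n + 1) (n + 1) (\<lambda>(i, j). f j $ i))"
      by (rule det_unit_lower_mult) (simp_all add: l_def E0)
    finally show ?thesis by (rule sym)
  qed
  also have "\<dots> = det (mat (n + 1) (n + 1) (\<lambda>(i, j). if i < n then (E * f j) $ i else L (E * f j)))"
  proof -
    \<comment> \<open>The last row is replaced by the values of the functional on the columns.\<close>
    define l where "l i k = (if i < n then (if k = i then 1 else 0) else w k)" for i k
    have "mat (n + 1) (n + 1) (\<lambda>(i, j). if i < n then (E * f j) $ i else L (E * f j))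
        = mat (n + 1) (n + 1) (\<lambda>(i, j). \<Sum>k<n + 1. l i k * (E * f j) $ k)"
      by (intro eq_matI) (auto simp: l_def L_def lessThan_Suc_atMost if_distrib[of "\<lambda>x. x * _"] cong: if_cong)
    also have "det \<dots> = det (mat (n + 1) (n + 1) (\<lambda>(i, j). (E * f j) $ i))"
      by (rule det_unit_lower_mult) (use assms(2) in \<open>auto simp: l_def less_Suc_eq\<close>)
    finally show ?thesis by (rule sym)
  qed
  also have "\<dots> = det (mat n n (\<lambda>(i, j). kernel_col 0 j $ i)) * L (E * kernel_col c n)"
  proof -
    let ?A = "mat (n + 1) (n + 1) (\<lambda>(i, j). if i < n then (E * f j) $ i else L (E * f j))"
    have f: "E * f j = (if j < n then kernel_col 0 j else E * kernel_col c n)" for j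
      using E_diff[of j] by (simp add: f_def algebra_simps)
    have "det ?A = (\<Sum>j<n + 1. ?A $$ (n, j) * cofactor ?A n j)"
      by (rule laplace_expansion_row) auto
    also have "\<dots> = ?A $$ (n, n) * cofactor ?A n n"
      by (subst sum.remove[of _ n]) (auto intro!: sum.neutral simp: f assms(3))
    also have "mat_delete ?A n n = mat n n (\<lambda>(i, j). kernel_col 0 j $ i)"
      by (rule eq_matI) (auto simp: mat_delete_def f)
    then have "cofactor ?A n n = det (mat n n (\<lambda>(i, j). kernel_col 0 j $ i))"
      by (simp add: cofactor_def)
    finally show ?thesis
      by (simp add: f)
  qed
  also have "L (E * kernel_col c n) = (\<Sum>k\<le>n. c ^ k * L (kernel_col 0 (n + k)))"
  proof -
    have *: "E * kernel_col c n = (\<Sum>k<m. fps_const (c ^ k) * kernel_col 0 (n + k))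
        + fps_const (c ^ m) * (E * kernel_col c (n + m))" for m
    proof (induction m)
      case (Suc m)
      then have "E * kernel_col c n = (\<Sum>k<m. fps_const (c ^ k) * kernel_col 0 (n + k))
          + fps_const (c ^ m) * (kernel_col 0 (n + m) + fps_const c * (E * kernel_col c (Suc (n + m))))"
        by (simp only: E_diff[of "n + m", symmetric])
      then show ?case
        by (simp add: algebra_simps flip: fps_const_mult)
    qed simp
    \<comment> \<open>The expansion can be cut off after \<open>n + 1\<close> terms, as the remainder vanishes modulo \<open>X^(n + 1)\<close>.\<close>
    have "(E * kernel_col c (2 * n + 1)) $ m = 0" if "m \<le> n" for m
      using that by (auto simp: fps_mult_nth kernel_col_nth_eq_0 intro!: sum.neutral)
    then have "L (E * kernel_col c n) = L (\<Sum>k<n + 1. fps_const (c ^ k) * kernel_col 0 (n + k))"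
      unfolding L_def using *[of "n + 1"] by (intro sum.cong) (auto simp: mult_2 add_ac)
    also have "\<dots> = (\<Sum>k\<le>n. c ^ k * L (kernel_col 0 (n + k)))"
      unfolding L_def
      by (simp add: fps_sum_nth sum_distrib_left lessThan_Suc_atMost mult_ac) (rule sum.swap)
    finally show ?thesis .
  qed
  finally show ?thesis .
qed

section \<open>A Jacobi polynomial and its quadratic transformation\<close>

text \<open>The coefficient of \<open>\<alpha>^m\<close> in the polynomial \<open>2F1(- n, - 3 n - 3/2; - 4 n - 2; - 4 \<alpha>)\<close>. It is zero for
\<open>m > n\<close> because of the binomial coefficient, so the zero of the denominator product at \<open>m > 4 n + 2\<close>
does no harm.\<close>

definition psi :: "nat \<Rightarrow> nat \<Rightarrow> rat" where
  "psi n m = 4 ^ m * of_nat (n choose m) * (\<Prod>i<m. 3 * of_nat n + 3 / 2 - of_nat i)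
     / (\<Prod>i<m. 4 * of_nat n + 2 - of_nat i)"

lemma psi_0 [simp]: "psi n 0 = 1"
  by (simp add: psi_def)

lemma psi_eq_0: "m > n \<Longrightarrow> psi n m = 0"
  by (simp add: psi_def)

lemma psi_Suc:
  "(of_nat m + 1) * (4 * of_nat n + 2 - of_nat m) * psi n (Suc m)
     = (of_nat n - of_nat m) * (12 * of_nat n + 6 - 4 * of_nat m) * psi n m"
proof (cases "m < n")
  case True
  have "Suc m * (n choose Suc m) = (n - m) * (n choose m)"
    by (rule Suc_times_choose_Suc)
  from arg_cong[OF this, of "of_nat :: nat \<Rightarrow> rat"] True
  have bin: "(of_nat m + 1) * of_nat (n choose Suc m) = (of_nat n - of_nat m) * (of_nat (n choose m) :: rat)"
    by (simp add: of_nat_diff algebra_simps)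
  define A where "A = (\<Prod>i<m. 3 * of_nat n + 3 / 2 - of_nat i :: rat)"
  define B where "B = (\<Prod>i<m. 4 * of_nat n + 2 - of_nat i :: rat)"
  define d where "d = (4 * of_nat n + 2 - of_nat m :: rat)"
  have "d \<noteq> 0"
  proof -
    have "of_nat m < (of_nat n :: rat)"
      using True by simp
    moreover have "of_nat n \<ge> (0 :: rat)"
      by simp
    ultimately show ?thesis
      unfolding d_def by linarith
  qed
  have "(of_nat m + 1) * d * psi n (Suc m)
      = 4 * 4 ^ m * ((of_nat m + 1) * of_nat (n choose Suc m)) * (A * (3 * of_nat n + 3 / 2 - of_nat m)) / B"
    using \<open>d \<noteq> 0\<close> by (simp add: psi_def A_def[symmetric] B_def[symmetric] d_def[symmetric])
  also have "\<dots> = (of_nat n - of_nat m) * (12 * of_nat n + 6 - 4 * of_nat m)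
      * (4 ^ m * of_nat (n choose m) * A / B)"
    unfolding bin by (cases "B = 0") (simp_all add: field_simps)
  finally show ?thesis
    by (simp add: psi_def A_def B_def d_def)
qed (cases "m = n"; simp add: psi_eq_0)

lemma fps_compose_mult_nth:
  fixes f g h :: "'a :: comm_ring_1 fps"
  assumes "g $ 0 = 0"
  shows "((f oo g) * h) $ k = (\<Sum>m\<le>k. f $ m * (g ^ m * h) $ k)"
proof -
  have *: "(f oo g) $ i = (\<Sum>m\<le>k. f $ m * g ^ m $ i)" if "i \<le> k" for i
    unfolding fps_compose_nth using that assms
    by (intro sum.mono_neutral_left) (auto simp: startsby_zero_power_prefix)
  have "((f oo g) * h) $ k = (\<Sum>i=0..k. \<Sum>m\<le>k. f $ m * (g ^ m $ i * h $ (k - i)))"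
    unfolding fps_mult_nth by (intro sum.cong) (simp_all add: * sum_distrib_right mult.assoc)
  also have "\<dots> = (\<Sum>m\<le>k. \<Sum>i=0..k. f $ m * (g ^ m $ i * h $ (k - i)))"
    by (rule sum.swap)
  finally show ?thesis
    by (simp add: fps_mult_nth sum_distrib_left)
qed

lemma fps_X_mult_deriv_nth:
  fixes f :: "rat fps"
  shows "(fps_X * fps_deriv f) $ m = of_nat m * f $ m"
    and "(fps_X * fps_deriv (fps_deriv f)) $ m = of_nat m * (of_nat m + 1) * f $ Suc m"
    and "(fps_X ^ 2 * fps_deriv (fps_deriv f)) $ m = of_nat m * (of_nat m - 1) * f $ m"
proof -
  show "(fps_X * fps_deriv f) $ m = of_nat m * f $ m"
    unfolding fps_X_mult_nth by (cases m) simp_all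
  show "(fps_X * fps_deriv (fps_deriv f)) $ m = of_nat m * (of_nat m + 1) * f $ Suc m"
    unfolding fps_X_mult_nth by (cases m) simp_all
  consider "m < 2" | k where "m = Suc (Suc k)"
    by (metis One_nat_def Suc_1 add_2_eq_Suc less_eqE not_less)
  then show "(fps_X ^ 2 * fps_deriv (fps_deriv f)) $ m = of_nat m * (of_nat m - 1) * f $ m"
    unfolding fps_X_power_mult_nth by cases (auto simp: less_Suc_eq numeral_2_eq_2)
qed

text \<open>The polynomial \<open>(1 + 2 u) \<psi>(u + u^2)\<close>, as a power series in \<open>u\<close>; this is \<open>\<psi>(\<alpha>) d\<alpha> / du\<close> for
\<open>\<alpha> = u + u^2\<close>.\<close>

definition psi_lift :: "nat \<Rightarrow> rat fps" where
  "psi_lift n = (1 + 2 * fps_X) * (Abs_fps (psi n) oo (fps_X + fps_X ^ 2))"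

lemma psi_ODE:
  fixes n :: nat
  defines "F \<equiv> Abs_fps (psi n)" and "c \<equiv> of_nat n :: rat fps"
  shows "(fps_X + 4 * fps_X ^ 2) * fps_deriv (fps_deriv F)
    - ((4 * c + 2) + (16 * c + 2) * fps_X) * fps_deriv F + 6 * c * (2 * c + 1) * F = 0"
proof (rule fps_ext)
  fix m
  have c: "c = fps_const (of_nat n)"
    by (simp add: c_def fps_of_nat)
  have "(fps_X + 4 * fps_X ^ 2) * fps_deriv (fps_deriv F)
      - ((4 * c + 2) + (16 * c + 2) * fps_X) * fps_deriv F + 6 * c * (2 * c + 1) * F
     = fps_X * fps_deriv (fps_deriv F) + fps_const 4 * (fps_X ^ 2 * fps_deriv (fps_deriv F))
      - fps_const (4 * of_nat n + 2) * fps_deriv F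
      - fps_const (16 * of_nat n + 2) * (fps_X * fps_deriv F)
      + fps_const (6 * of_nat n * (2 * of_nat n + 1)) * F"
    unfolding c by (simp add: algebra_simps numeral_fps_const flip: fps_const_add fps_const_mult)
  then have "((fps_X + 4 * fps_X ^ 2) * fps_deriv (fps_deriv F)
      - ((4 * c + 2) + (16 * c + 2) * fps_X) * fps_deriv F + 6 * c * (2 * c + 1) * F) $ m
     = of_nat m * (of_nat m + 1) * psi n (Suc m) + 4 * (of_nat m * (of_nat m - 1) * psi n m)
      - (4 * of_nat n + 2) * ((of_nat m + 1) * psi n (Suc m))
      - (16 * of_nat n + 2) * (of_nat m * psi n m)
      + 6 * of_nat n * (2 * of_nat n + 1) * psi n m"
    by (simp only: fps_add_nth fps_sub_nth fps_mult_left_const_nth fps_X_mult_deriv_nth)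
      (simp add: F_def add.commute)
  also have "\<dots> = (of_nat n - of_nat m) * (12 * of_nat n + 6 - 4 * of_nat m) * psi n m
      - (of_nat m + 1) * (4 * of_nat n + 2 - of_nat m) * psi n (Suc m)"
    by (simp add: algebra_simps)
  also have "\<dots> = 0"
    by (simp only: psi_Suc diff_self)
  finally show "((fps_X + 4 * fps_X ^ 2) * fps_deriv (fps_deriv F)
      - ((4 * c + 2) + (16 * c + 2) * fps_X) * fps_deriv F + 6 * c * (2 * c + 1) * F) $ m = 0 $ m"
    by simp
qed

text \<open>The differential equation of \<open>\<psi>\<close> transforms into another hypergeometric equation, since
\<open>1 + 4 \<alpha> = (1 + 2 u)^2\<close>. This is why the coefficients of \<open>psi_lift\<close> satisfy a two-term recurrence.\<close>

lemma psi_lift_ODE: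
  fixes n :: nat
  defines "P \<equiv> psi_lift n" and "c \<equiv> of_nat n :: rat fps"
  shows "(fps_X + fps_X ^ 2) * fps_deriv (fps_deriv P) - (4 * c + 2) * (1 + 2 * fps_X) * fps_deriv P
    + (2 * c + 1) * (6 * c + 4) * P = 0"
proof -
  define a where "a = (fps_X + fps_X ^ 2 :: rat fps)"
  have a0: "a $ 0 = 0" and a': "fps_deriv a = 1 + 2 * fps_X"
    by (simp_all add: a_def fps_deriv_power)
  define F where "F = Abs_fps (psi n)"
  define F0 where "F0 = F oo a"
  define F1 where "F1 = fps_deriv F oo a"
  define F2 where "F2 = fps_deriv (fps_deriv F) oo a"
  have F0': "fps_deriv F0 = F1 * (1 + 2 * fps_X)" and F1': "fps_deriv F1 = F2 * (1 + 2 * fps_X)"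
    by (simp_all add: F0_def F1_def F2_def fps_compose_deriv[OF a0] a')
  have "((fps_X + 4 * fps_X ^ 2) * fps_deriv (fps_deriv F)
    - ((4 * c + 2) + (16 * c + 2) * fps_X) * fps_deriv F + 6 * c * (2 * c + 1) * F) oo a = 0"
    using psi_ODE[of n] by (simp add: F_def c_def)
  then have ode: "(a + 4 * a ^ 2) * F2 - ((4 * c + 2) + (16 * c + 2) * a) * F1
      + 6 * c * (2 * c + 1) * F0 = 0"
    by (simp add: fps_compose_add_distrib fps_compose_sub_distrib fps_compose_mult_distrib[OF a0]
        fps_compose_power[OF a0, symmetric] F0_def F1_def F2_def c_def a0)
  have P: "P = (1 + 2 * fps_X) * F0"
    by (simp add: P_def psi_lift_def F0_def F_def a_def)
  have P': "fps_deriv P = 2 * F0 + (1 + 2 * fps_X) ^ 2 * F1"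
    unfolding P by (simp add: F0' power2_eq_square algebra_simps)
  have P'': "fps_deriv (fps_deriv P) = 6 * (1 + 2 * fps_X) * F1 + (1 + 2 * fps_X) ^ 3 * F2"
    unfolding P' by (simp add: F0' F1' fps_deriv_power power2_eq_square power3_eq_cube algebra_simps)
  have "(fps_X + fps_X ^ 2) * fps_deriv (fps_deriv P) - (4 * c + 2) * (1 + 2 * fps_X) * fps_deriv P
      + (2 * c + 1) * (6 * c + 4) * P
    = (1 + 2 * fps_X) * ((a + 4 * a ^ 2) * F2 - ((4 * c + 2) + (16 * c + 2) * a) * F1
      + 6 * c * (2 * c + 1) * F0)"
  proof -
    have "(x + x ^ 2) * (6 * (1 + 2 * x) * g1 + (1 + 2 * x) ^ 3 * g2)
        - (4 * c + 2) * (1 + 2 * x) * (2 * g0 + (1 + 2 * x) ^ 2 * g1)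
        + (2 * c + 1) * (6 * c + 4) * ((1 + 2 * x) * g0)
      = (1 + 2 * x) * ((x + x ^ 2 + 4 * (x + x ^ 2) ^ 2) * g2
        - ((4 * c + 2) + (16 * c + 2) * (x + x ^ 2)) * g1 + 6 * c * (2 * c + 1) * g0)"
      for x g0 g1 g2 :: "rat fps"
      by (simp add: algebra_simps power2_eq_square power3_eq_cube)
    then show ?thesis
      unfolding P'' unfolding P' unfolding P a_def by (simp only:)
  qed
  then show ?thesis
    by (simp add: ode)
qed

lemma psi_lift_0 [simp]: "psi_lift n $ 0 = 1"
  by (simp add: psi_lift_def)

lemma psi_lift_Suc:
  "(of_nat a + 1) * (4 * of_nat n + 2 - of_nat a) * psi_lift n $ Suc a
     = (2 * of_nat n + 1 - of_nat a) * (6 * of_nat n + 4 - of_nat a) * psi_lift n $ a"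
proof -
  define P where "P = psi_lift n"
  have c: "of_nat n = fps_const (of_nat n :: rat)"
    by (simp add: fps_of_nat)
  have "0 = fps_X * fps_deriv (fps_deriv P) + fps_X ^ 2 * fps_deriv (fps_deriv P)
     - fps_const (4 * of_nat n + 2) * fps_deriv P
     - fps_const (8 * of_nat n + 4) * (fps_X * fps_deriv P)
     + fps_const ((2 * of_nat n + 1) * (6 * of_nat n + 4)) * P"
  proof -
    have "fps_const (4 * of_nat n + 2 :: rat) = 4 * of_nat n + 2"
      "fps_const (8 * of_nat n + 4 :: rat) = 8 * of_nat n + 4"
      "fps_const ((2 * of_nat n + 1) * (6 * of_nat n + 4) :: rat) = (2 * of_nat n + 1) * (6 * of_nat n + 4)"
      by (simp_all add: c numeral_fps_const)
    then show ?thesis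
      unfolding psi_lift_ODE[of n, symmetric] P_def by (simp only:) (simp add: algebra_simps)
  qed
  then have "0 = of_nat a * (of_nat a + 1) * P $ Suc a + of_nat a * (of_nat a - 1) * P $ a
      - (4 * of_nat n + 2) * ((of_nat a + 1) * P $ Suc a)
      - (8 * of_nat n + 4) * (of_nat a * P $ a)
      + (2 * of_nat n + 1) * (6 * of_nat n + 4) * P $ a"
    by (auto dest!: arg_cong[where f = "\<lambda>f. f $ a"]
        simp only: fps_add_nth fps_sub_nth fps_mult_left_const_nth fps_X_mult_deriv_nth
        fps_deriv_nth fps_zero_nth of_nat_add of_nat_1 Suc_eq_plus1 mult.assoc)
  then show ?thesis
    unfolding P_def[symmetric] by (simp add: algebra_simps)
qed

lemma psi_lift_nth:
  assumes "a \<le> 4 * n + 2"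
  shows "of_nat ((4 * n + 2) choose a) * psi_lift n $ a
       = of_nat ((2 * n + 1) choose a) * of_nat ((6 * n + 4) choose a)"
  using assms
proof (induction a)
  case (Suc a)
  define N where "N = of_nat n * (2 :: rat) + 1"
  have rec: "(of_nat a + 1) * of_nat (m choose Suc a) = (of_nat m - of_nat a) * (of_nat (m choose a) :: rat)" for m
  proof (cases "a \<le> m")
    case True
    have "of_nat (Suc a * (m choose Suc a)) = (of_nat ((m - a) * (m choose a)) :: rat)"
      by (simp only: Suc_times_choose_Suc)
    then show ?thesis
      using True by (simp add: of_nat_diff algebra_simps)
  qed (simp add: binomial_eq_0)
  define A B C where "A = (of_nat ((4 * n + 2) choose a) :: rat)" and "B = (of_nat ((2 * n + 1) choose a) :: rat)"
    and "C = (of_nat ((6 * n + 4) choose a) :: rat)"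
  define A' B' C' where "A' = (of_nat ((4 * n + 2) choose Suc a) :: rat)" and "B' = (of_nat ((2 * n + 1) choose Suc a) :: rat)"
    and "C' = (of_nat ((6 * n + 4) choose Suc a) :: rat)"
  define k where "k = (of_nat a + 1 :: rat)"
  have "k \<noteq> 0"
    unfolding k_def by (metis of_nat_Suc of_nat_neq_0 add.commute)
  have r: "k * A' = (4 * of_nat n + 2 - of_nat a) * A" "k * B' = (2 * of_nat n + 1 - of_nat a) * B"
    "k * C' = (6 * of_nat n + 4 - of_nat a) * C"
    using rec[of "4 * n + 2"] rec[of "2 * n + 1"] rec[of "6 * n + 4"]
    by (simp_all only: A_def B_def C_def A'_def B'_def C'_def k_def of_nat_add of_nat_mult of_nat_numeral of_nat_1)
  have IH: "A * psi_lift n $ a = B * C"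
    using Suc by (simp add: A_def B_def C_def)
  have "k * k * (A' * psi_lift n $ Suc a) = A * (k * (4 * of_nat n + 2 - of_nat a) * psi_lift n $ Suc a)"
    using r(1) by (simp add: mult_ac)
  also have "\<dots> = (2 * of_nat n + 1 - of_nat a) * (6 * of_nat n + 4 - of_nat a) * (A * psi_lift n $ a)"
    unfolding k_def psi_lift_Suc by (simp only: mult_ac)
  also have "\<dots> = ((2 * of_nat n + 1 - of_nat a) * B) * ((6 * of_nat n + 4 - of_nat a) * C)"
    unfolding IH by (simp only: mult_ac)
  also have "\<dots> = k * k * (B' * C')"
    unfolding r[symmetric] by (simp only: mult_ac)
  finally show ?case
    using \<open>k \<noteq> 0\<close> by (simp add: A'_def B'_def C'_def del: binomial_Suc_Suc)
qed simp

text \<open>The coefficient of \<open>X^a\<close> in \<open>((1 + X) - X)^m (1 + X)^m\<close>.\<close>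

lemma sum_choose_alternating:
  "(\<Sum>b\<le>a. (- 1) ^ b * of_nat (m choose b) * of_nat ((2 * m - b) choose (a - b))) = (of_nat (m choose a) :: 'a :: comm_ring_1)"
proof -
  let ?u = "1 + fps_X :: 'a fps"
  have "?u ^ m = (- fps_X + ?u) ^ m * ?u ^ m"
    by simp
  also have "\<dots> = (\<Sum>b\<le>m. of_nat (m choose b) * (- fps_X) ^ b * ?u ^ (2 * m - b))"
    unfolding binomial_ring[of "- fps_X" ?u] sum_distrib_right
    by (intro sum.cong refl) (simp add: mult.assoc mult_2 flip: power_add)
  also have "\<dots> = (\<Sum>b\<le>m. fps_const ((- 1) ^ b * of_nat (m choose b)) * (fps_X ^ b * ?u ^ (2 * m - b)))"
    by (intro sum.cong refl)
      (simp add: power_minus[of fps_X] mult_ac flip: fps_of_nat fps_const_mult fps_const_power fps_const_neg)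
  finally have "(?u ^ m) $ a
      = (\<Sum>b\<le>m. fps_const ((- 1) ^ b * of_nat (m choose b)) * (fps_X ^ b * ?u ^ (2 * m - b))) $ a"
    by (rule arg_cong)
  then have "of_nat (m choose a)
      = (\<Sum>b\<le>m. (- 1) ^ b * of_nat (m choose b) * (if a < b then 0 else of_nat ((2 * m - b) choose (a - b))) :: 'a)"
    by (simp only: one_plus_X_power_nth fps_sum_nth fps_mult_left_const_nth fps_X_power_mult_nth)
  also have "\<dots> = (\<Sum>b\<le>a. (- 1) ^ b * of_nat (m choose b) * of_nat ((2 * m - b) choose (a - b)))"
    by (intro sum.mono_neutral_cong) (auto simp: binomial_eq_0)
  finally show ?thesis ..
qed

text \<open>Modulo \<open>u^(4 n + 3)\<close>, the polynomial \<open>P = psi_lift n\<close> satisfies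
\<open>P(u) = (1 + u)^(6 n + 4) P(- u / (1 + u))\<close>.\<close>

lemma psi_lift_pfaff:
  assumes "a \<le> 4 * n + 2"
  shows "psi_lift n $ a = (\<Sum>b\<le>a. (- 1) ^ b * psi_lift n $ b * of_nat ((6 * n + 4 - b) choose (a - b)))"
proof -
  define A where "A = (of_nat ((4 * n + 2) choose a) :: rat)"
  have "A \<noteq> 0"
    using assms by (simp add: A_def)
  have *: "A * (psi_lift n $ b * of_nat ((6 * n + 4 - b) choose (a - b)))
      = of_nat ((6 * n + 4) choose a) * (of_nat ((2 * n + 1) choose b) * of_nat ((4 * n + 2 - b) choose (a - b)))"
    if "b \<le> a" for b
  proof -
    define B where "B = (of_nat (a choose b) :: rat)"
    have "B \<noteq> 0"
      using that by (simp add: B_def)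
    have 1: "A * B = of_nat ((4 * n + 2) choose b) * of_nat ((4 * n + 2 - b) choose (a - b))"
      unfolding A_def B_def of_nat_mult[symmetric] using choose_mult[OF that assms] by simp
    have 2: "of_nat ((6 * n + 4) choose a) * B = of_nat ((6 * n + 4) choose b) * (of_nat ((6 * n + 4 - b) choose (a - b)) :: rat)"
      unfolding B_def of_nat_mult[symmetric] using choose_mult[OF that, of "6 * n + 4"] assms by simp
    have "B * (A * (psi_lift n $ b * of_nat ((6 * n + 4 - b) choose (a - b))))
      = (of_nat ((4 * n + 2) choose b) * psi_lift n $ b) * of_nat ((4 * n + 2 - b) choose (a - b)) * of_nat ((6 * n + 4 - b) choose (a - b))"
      using 1 by (simp add: mult_ac)
    also have "\<dots> = of_nat ((2 * n + 1) choose b) * of_nat ((4 * n + 2 - b) choose (a - b)) * (of_nat ((6 * n + 4) choose b) * of_nat ((6 * n + 4 - b) choose (a - b)))"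
      using that assms by (subst psi_lift_nth) (simp_all only: mult_ac le_trans)
    also have "\<dots> = B * (of_nat ((6 * n + 4) choose a) * (of_nat ((2 * n + 1) choose b) * of_nat ((4 * n + 2 - b) choose (a - b))))"
      unfolding 2[symmetric] by (simp only: mult_ac)
    finally show ?thesis
      using \<open>B \<noteq> 0\<close> by simp
  qed
  have "A * psi_lift n $ a = of_nat ((6 * n + 4) choose a) * of_nat ((2 * n + 1) choose a)"
    unfolding A_def psi_lift_nth[OF assms] by (rule mult.commute)
  also have "\<dots> = (\<Sum>b\<le>a. (- 1) ^ b * (of_nat ((6 * n + 4) choose a) * (of_nat ((2 * n + 1) choose b) * of_nat ((4 * n + 2 - b) choose (a - b)))))"
    unfolding sum_choose_alternating[of "2 * n + 1" a, symmetric] sum_distrib_left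
    by (intro sum.cong) (simp_all add: mult_ac)
  also have "\<dots> = (\<Sum>b\<le>a. (- 1) ^ b * (A * (psi_lift n $ b * of_nat ((6 * n + 4 - b) choose (a - b)))))"
    by (intro sum.cong refl) (simp only: * atMost_iff)
  also have "\<dots> = A * (\<Sum>b\<le>a. (- 1) ^ b * psi_lift n $ b * of_nat ((6 * n + 4 - b) choose (a - b)))"
    unfolding sum_distrib_left by (intro sum.cong) (simp_all only: mult_ac)
  finally show ?thesis
    using \<open>A \<noteq> 0\<close> by simp
qed

section \<open>The functional as a residue\<close>

text \<open>\<open>binom_series a\<close> is \<open>(1 + u)^a\<close>; fixing the types to \<open>rat\<close> keeps statements free of annotations.\<close>

abbreviation binom_series :: "rat \<Rightarrow> rat fps" where
  "binom_series \<equiv> fps_binomial"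

lemma binom_series_minus_nth: "binom_series (- of_nat s :: rat) $ k = (- 1) ^ k * of_nat ((s + k - 1) choose k)" if "s > 0"
proof -
  have "(of_nat s + of_nat k - 1 :: rat) = of_nat (s + k - 1)"
    using that by (simp add: of_nat_diff)
  then show ?thesis
    unfolding fps_binomial_nth gbinomial_minus binomial_gbinomial by (simp only:)
qed

text \<open>The residue at \<open>u = 0\<close> of \<open>Y^m \<eta>\<close>, where \<open>Y = u^2 / (1 + u)\<close> and
\<open>\<eta> = psi_lift n du / (u (1 + u))^(2 n + 2)\<close>. The residue equals \<open>- J\<close> and \<open>J\<close> for the same sum \<open>J\<close>: expanding the negative
power of \<open>1 + u\<close> directly gives \<open>- J\<close>, and using the Pfaff transformation first gives \<open>J\<close>.\<close>

lemma psi_lift_residue: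
  assumes "m \<ge> 1" "m \<le> n"
  shows "(psi_lift n * binom_series (- of_nat (2 * n + 2 + m))) $ (2 * n + 1 - 2 * m) = 0"
proof -
  define q s where "q = 2 * n + 1 - 2 * m" and "s = 2 * n + 2 + m"
  have le: "q \<le> 4 * n + 2" and "odd q" and sq: "s + q - 1 = 4 * n + 2 - m" and "s > 0"
    using assms by (auto simp: q_def s_def)
  let ?I = "(psi_lift n * binom_series (- of_nat s)) $ q"
  let ?J = "\<Sum>b\<le>q. (- 1) ^ b * psi_lift n $ b * of_nat ((4 * n + 2 - m - b) choose (q - b))"
  have "?I = (\<Sum>b\<le>q. psi_lift n $ b * ((- 1) ^ (q - b) * of_nat ((4 * n + 2 - m - b) choose (q - b))))"
    unfolding fps_mult_nth atLeast0AtMost binom_series_minus_nth[OF \<open>s > 0\<close>]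
  proof (intro sum.cong refl)
    fix b
    assume "b \<in> {..q}"
    then have "s + (q - b) - 1 = 4 * n + 2 - m - b"
      using sq by simp
    then show "psi_lift n $ b * ((- 1) ^ (q - b) * of_nat ((s + (q - b) - 1) choose (q - b)))
        = psi_lift n $ b * ((- 1) ^ (q - b) * of_nat ((4 * n + 2 - m - b) choose (q - b)))"
      by simp
  qed
  also have "\<dots> = - ?J"
    unfolding sum_negf[symmetric]
    by (intro sum.cong refl) (use \<open>odd q\<close> in \<open>auto simp: minus_one_power_iff\<close>)
  finally have 1: "?I = - ?J" .
  have "?I = (\<Sum>a\<le>q. \<Sum>b\<le>a. (- 1) ^ b * psi_lift n $ b * (of_nat ((6 * n + 4 - b) choose (a - b)) * binom_series (- of_nat s) $ (q - a)))"
    unfolding fps_mult_nth atLeast0AtMost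
  proof (intro sum.cong refl)
    fix a
    assume "a \<in> {..q}"
    then have "a \<le> 4 * n + 2"
      using le by simp
    then show "psi_lift n $ a * binom_series (- of_nat s) $ (q - a)
      = (\<Sum>b\<le>a. (- 1) ^ b * psi_lift n $ b * (of_nat ((6 * n + 4 - b) choose (a - b)) * binom_series (- of_nat s) $ (q - a)))"
      by (subst psi_lift_pfaff) (simp_all add: sum_distrib_right mult.assoc)
  qed
  also have "\<dots> = (\<Sum>b\<le>q. \<Sum>a=b..q. (- 1) ^ b * psi_lift n $ b * (of_nat ((6 * n + 4 - b) choose (a - b)) * binom_series (- of_nat s) $ (q - a)))"
    unfolding sum.Sigma[OF finite_atMost ballI[OF finite_atMost]] sum.Sigma[OF finite_atMost ballI[OF finite_atLeastAtMost]]
    by (rule sum.reindex_bij_witness[of _ "\<lambda>(b, a). (a, b)" "\<lambda>(a, b). (b, a)"]) auto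
  also have "\<dots> = ?J"
  proof (intro sum.cong refl)
    fix b
    assume "b \<in> {..q}"
    then have b: "b \<le> q" by simp
    have "(\<Sum>a=b..q. of_nat ((6 * n + 4 - b) choose (a - b)) * binom_series (- of_nat s) $ (q - a))
        = (\<Sum>a=0..q - b. of_nat ((6 * n + 4 - b) choose a) * binom_series (- of_nat s) $ (q - b - a))"
      by (rule sum.reindex_bij_witness[of _ "\<lambda>a. a + b" "\<lambda>a. a - b"]) (use b in auto)
    also have "\<dots> = (binom_series (of_nat (6 * n + 4 - b)) * binom_series (- of_nat s)) $ (q - b)"
      by (simp add: fps_mult_nth binomial_gbinomial)
    also have "\<dots> = binom_series (of_nat (4 * n + 2 - m - b)) $ (q - b)"
    proof -
      have "of_nat (6 * n + 4 - b) + - of_nat s = (of_nat (4 * n + 2 - m - b) :: rat)"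
        using b assms unfolding s_def q_def by (simp add: of_nat_diff)
      then show ?thesis
        by (simp only: fps_binomial_add_mult[symmetric])
    qed
    also have "\<dots> = of_nat ((4 * n + 2 - m - b) choose (q - b))"
      by (simp add: binomial_gbinomial)
    finally show "(\<Sum>a=b..q. (- 1) ^ b * psi_lift n $ b * (of_nat ((6 * n + 4 - b) choose (a - b)) * binom_series (- of_nat s) $ (q - a)))
      = (- 1) ^ b * psi_lift n $ b * of_nat ((4 * n + 2 - m - b) choose (q - b))"
      by (simp only: sum_distrib_left[symmetric])
  qed
  finally show ?thesis
    using 1 by (simp add: q_def s_def)
qed

text \<open>With \<open>\<alpha> = u + u^2\<close> this is the residue of \<open>\<alpha>^(t - m - 1) d\<alpha>\<close>.\<close>

lemma alpha_residue:
  "((fps_X + fps_X ^ 2) ^ t * ((1 + 2 * fps_X) * binom_series (- of_nat (m + 1)))) $ m = (if t = m then 1 else 0)"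
proof (cases "t \<le> m")
  case False
  have *: "(fps_X + fps_X ^ 2) ^ t = fps_X ^ t * (1 + fps_X :: rat fps) ^ t"
    unfolding power_mult_distrib[symmetric] by (simp add: algebra_simps power2_eq_square)
  show ?thesis
    unfolding * mult.assoc fps_X_power_mult_nth using False by simp
next
  case True
  define e where "e = m - t"
  have "(fps_X + fps_X ^ 2) ^ t = fps_X ^ t * binom_series (of_nat t)"
    unfolding fps_binomial_of_nat power_mult_distrib[symmetric] by (simp add: algebra_simps power2_eq_square)
  then have "(fps_X + fps_X ^ 2) ^ t * ((1 + 2 * fps_X) * binom_series (- of_nat (m + 1)))
      = fps_X ^ t * ((1 + 2 * fps_X) * (binom_series (of_nat t) * binom_series (- of_nat (m + 1))))"
    by (simp only: mult_ac)
  also have "binom_series (of_nat t) * binom_series (- of_nat (m + 1)) = binom_series (- of_nat (e + 1))"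
  proof -
    have "of_nat t + - of_nat (m + 1) = (- of_nat (e + 1) :: rat)"
      using True by (simp add: e_def of_nat_diff)
    then show ?thesis
      by (simp only: fps_binomial_add_mult[symmetric])
  qed
  finally have "((fps_X + fps_X ^ 2) ^ t * ((1 + 2 * fps_X) * binom_series (- of_nat (m + 1)))) $ m
      = ((1 + 2 * fps_X) * binom_series (- of_nat (e + 1))) $ e"
    using True by (simp only: fps_X_power_mult_nth e_def) simp
  also have "\<dots> = (if e = 0 then 1 else 0)"
  proof (cases e)
    case (Suc d)
    define y where "y = (- (of_nat d + 2) :: rat) gchoose d"
    have "(of_nat d + 1) * ((- (of_nat d + 2) :: rat) gchoose Suc d) = (- (of_nat d + 2) - of_nat d) * y"
      using gbinomial_absorption'[of "Suc d" "- (of_nat d + 2) :: rat"] gbinomial_mult_1[of "- (of_nat d + 2) :: rat" d]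
      unfolding y_def by (simp add: algebra_simps)
    then have "(of_nat d + 1) * (((- (of_nat d + 2) :: rat) gchoose Suc d) + 2 * y) = 0"
      by (simp add: algebra_simps)
    moreover have "(of_nat d + 1 :: rat) \<noteq> 0"
      by (metis of_nat_Suc of_nat_neq_0 add.commute)
    ultimately have "((- (of_nat d + 2) :: rat) gchoose Suc d) + 2 * y = 0"
      by simp
    moreover have "((1 + 2 * fps_X) * binom_series (- of_nat (e + 1))) $ e
        = ((- (of_nat d + 2) :: rat) gchoose Suc d) + 2 * y"
    proof -
      have "(1 + 2 * fps_X) * f = f + fps_const 2 * (fps_X * f)" for f :: "rat fps"
        by (simp add: algebra_simps numeral_fps_const)
      moreover have "- of_nat (e + 1) = (- (of_nat d + 2) :: rat)"
        using Suc by simp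
      ultimately show ?thesis
        unfolding y_def Suc
        by (simp only: fps_add_nth fps_mult_left_const_nth fps_X_mult_nth fps_binomial_nth) simp
    qed
    ultimately show ?thesis
      using Suc by simp
  qed simp
  also have "\<dots> = (if t = m then 1 else 0)"
    using True by (auto simp: e_def)
  finally show ?thesis .
qed

text \<open>The functional is \<open>f \<mapsto> Res f(Y) \<alpha> \<eta>\<close>. In the proof \<open>a\<close> stands for \<open>\<alpha>\<close>, \<open>Z\<close> for \<open>u^(2 n + 2) \<eta> / du\<close>,
and a residue is the coefficient of \<open>u^N\<close> with \<open>N = 2 n + 1\<close>.\<close>

lemma exists_kernel_functional:
  fixes n :: nat
  obtains w :: "nat \<Rightarrow> rat" where "w n = 1"
    and "\<And>j. j \<le> 2 * n \<Longrightarrow> (\<Sum>m\<le>n. w m * kernel_col 0 j $ m) = psi n (2 * n - j)"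
proof -
  define N where "N = 2 * n + 1"
  define a where "a = (fps_X + fps_X ^ 2 :: rat fps)"
  define Y where "Y = fps_X ^ 2 * binom_series (- 1 :: rat)"
  define Z where "Z = psi_lift n * binom_series (- of_nat (N + 1))"
  define w where "w m = (Y ^ m * (a * Z)) $ N" for m
  have a0: "a $ 0 = 0" and Y0: "Y $ 0 = 0"
    by (simp_all add: a_def Y_def)
  have Ypow: "Y ^ m = fps_X ^ (2 * m) * binom_series (- of_nat m)" for m
    by (simp add: Y_def power_mult_distrib power_mult fps_binomial_power)
  have a_eq: "a = fps_X * (1 + fps_X)"
    by (simp add: a_def algebra_simps power2_eq_square)
  have YX: "Y * (1 + fps_X) = fps_X ^ 2"
  proof -
    have "binom_series (- 1) * binom_series 1 = (1 :: rat fps)"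
      by (simp flip: fps_binomial_add_mult)
    then show ?thesis
      by (simp add: Y_def fps_binomial_1 mult.assoc)
  qed
  have aY: "a ^ 2 = (3 * Y + Y ^ 2) * a + Y"
  proof -
    have "a ^ 2 = Y * (1 + fps_X) * (1 + fps_X) ^ 2"
      unfolding YX a_eq by (simp add: power_mult_distrib)
    also have "\<dots> = Y * (3 * a + fps_X * fps_X ^ 2 + 1)"
      unfolding a_eq by (simp add: algebra_simps power2_eq_square)
    also have "\<dots> = (3 * Y + Y ^ 2) * a + Y"
      unfolding YX[symmetric] a_eq by (simp add: algebra_simps power2_eq_square)
    finally show ?thesis .
  qed
  define H where "H j = kernel_col 0 j oo Y" for j
  have H_rec: "H (Suc (Suc j)) = (3 * Y + Y ^ 2) * H (Suc j) + Y * H j" for j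
    by (simp add: H_def fps_compose_add_distrib fps_compose_mult_distrib[OF Y0]
        fps_compose_power[OF Y0, symmetric] Y0)
  have H0: "H 0 = 1" and H1: "H (Suc 0) = 3 * Y + Y ^ 2"
    by (simp_all add: H_def fps_compose_add_distrib fps_compose_mult_distrib[OF Y0]
        fps_compose_power[OF Y0, symmetric] Y0)
  have a_pow: "a ^ (Suc (Suc j)) = H (Suc j) * a + Y * H j" for j
  proof (induction j)
    case 0
    show ?case
      using aY by (simp add: H0 H1 power2_eq_square)
  next
    case (Suc j)
    have "a ^ Suc (Suc (Suc j)) = H (Suc j) * a ^ 2 + Y * H j * a"
      by (subst power_Suc, subst Suc) (simp add: algebra_simps power2_eq_square)
    then show ?case
      unfolding aY H_rec by (simp add: algebra_simps)
  qed
  have Y_vanish: "(Y ^ m * Z) $ N = 0" if "m \<ge> 1" for m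
  proof -
    have "Y ^ m * Z = fps_X ^ (2 * m) * (psi_lift n * (binom_series (- of_nat m) * binom_series (- of_nat (N + 1))))"
      unfolding Ypow Z_def by (simp only: mult_ac)
    also have "binom_series (- of_nat m) * binom_series (- of_nat (N + 1)) = binom_series (- of_nat (2 * n + 2 + m))"
    proof -
      have "- of_nat m + - of_nat (N + 1) = (- of_nat (2 * n + 2 + m) :: rat)"
        by (simp add: N_def)
      then show ?thesis
        by (simp only: fps_binomial_add_mult[symmetric])
    qed
    finally show ?thesis
      using psi_lift_residue[OF that, of n] by (simp add: fps_X_power_mult_nth N_def)
  qed
  have functional: "(\<Sum>m\<le>n. w m * f $ m) = ((f oo Y) * (a * Z)) $ N" for f
  proof -
    have "(\<Sum>m\<le>n. w m * f $ m) = (\<Sum>m\<le>N. w m * f $ m)"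
    proof (intro sum.mono_neutral_left ballI)
      fix m
      assume "m \<in> {..N} - {..n}"
      then have "N < 2 * m + 1"
        by (auto simp: N_def)
      moreover have "Y ^ m * (a * Z) = fps_X ^ (2 * m + 1) * (binom_series (- of_nat m) * ((1 + fps_X) * Z))"
        unfolding Ypow a_eq power_add power_one_right by (simp only: mult_ac)
      ultimately show "w m * f $ m = 0"
        unfolding w_def by (simp only: fps_X_power_mult_nth if_True mult_zero_left)
    qed (auto simp: N_def)
    then show ?thesis
      by (simp add: fps_compose_mult_nth[OF Y0] w_def mult.commute)
  qed
  have "w n = 1"
  proof -
    have "Y ^ n * (a * Z) = fps_X ^ N * (binom_series (- of_nat n) * ((1 + fps_X) * Z))"
      unfolding Ypow a_eq N_def power_add power_one_right by (simp only: mult_ac)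
    then show ?thesis
      unfolding w_def by (simp only: fps_X_power_mult_nth) (simp add: Z_def)
  qed
  moreover have "(\<Sum>m\<le>n. w m * kernel_col 0 j $ m) = psi n (2 * n - j)" if "j \<le> 2 * n" for j
  proof -
    have "(H j * a * Z) $ N = (a ^ Suc j * Z) $ N"
    proof (cases j)
      case (Suc i)
      have "(Y * H i * Z) $ N = (\<Sum>m\<le>N. kernel_col 0 i $ m * (Y ^ Suc m * Z) $ N)"
        unfolding H_def using fps_compose_mult_nth[OF Y0, of "kernel_col 0 i" "Y * Z" N]
        by (simp add: mult_ac power_Suc2)
      also have "\<dots> = 0"
      proof -
        have "(Y ^ Suc m * Z) $ N = 0" for m
          by (rule Y_vanish) simp
        then show ?thesis
          by (simp only: mult_zero_right sum.neutral_const)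
      qed
      finally show ?thesis
        unfolding Suc a_pow by (simp add: distrib_right)
    qed (simp add: H0)
    also have "a ^ Suc j * Z = (Abs_fps (psi n) oo a) * (a ^ Suc j * ((1 + 2 * fps_X) * binom_series (- of_nat (N + 1))))"
      unfolding Z_def psi_lift_def a_def[symmetric] by (simp only: mult_ac)
    also have "\<dots> $ N = (\<Sum>m\<le>N. psi n m * (a ^ (m + Suc j) * ((1 + 2 * fps_X) * binom_series (- of_nat (N + 1)))) $ N)"
      unfolding fps_compose_mult_nth[OF a0] by (simp only: power_add mult.assoc fps_nth_Abs_fps)
    also have "\<dots> = (\<Sum>m\<le>N. if m = 2 * n - j then psi n m else 0)"
      unfolding a_def alpha_residue using that by (intro sum.cong refl) (auto simp: N_def)
    also have "\<dots> = psi n (2 * n - j)"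
      by (simp add: N_def)
    finally show ?thesis
      unfolding functional H_def by (simp add: mult.assoc)
  qed
  ultimately show ?thesis
    by (rule that)
qed

section \<open>The sums of the theorem, re-expanded\<close>

text \<open>The coefficient of \<open>z^i\<close> in the sum of the theorem, for \<open>i \<le> n\<close>; this sum is a constant times
\<open>2F1(- n, 3 n + 3; 3/2; - z / 4)\<close>.\<close>

definition sum_coeff :: "nat \<Rightarrow> nat \<Rightarrow> rat" where
  "sum_coeff n i = fact n * fact (3 * n + i + 2) / (fact (3 * n + 2) * fact (n - i) * fact (2 * i + 1))"

lemma sum_coeff_Suc:
  assumes "i < n"
  shows "(of_nat i + 1) * (4 * of_nat i + 6) * sum_coeff n (Suc i)
       = (of_nat n - of_nat i) * (3 * of_nat n + 3 + of_nat i) * sum_coeff n i"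
proof -
  obtain d where n: "n = i + Suc d"
    using less_imp_Suc_add[OF assms] by auto
  define A B C E where "A = (fact (3 * n + i + 2) :: rat)" and "B = (fact d :: rat)"
    and "C = (fact (2 * i + 1) :: rat)" and "E = (fact n / fact (3 * n + 2) :: rat)"
  have pos: "B \<noteq> 0" "C \<noteq> 0"
    by (simp_all add: B_def C_def)
  have d: "of_nat n - of_nat i = (of_nat d + 1 :: rat)"
    by (simp add: n)
  have 1: "sum_coeff n i = E * A / ((of_nat d + 1) * B * C)"
    unfolding sum_coeff_def A_def B_def C_def E_def by (simp add: n add.commute)
  have "fact (3 * n + Suc i + 2) = (3 * of_nat n + 3 + of_nat i) * A"
    unfolding A_def by (simp add: algebra_simps)
  moreover have "fact (2 * Suc i + 1) = (2 * of_nat i + 3) * (2 * of_nat i + 2) * C"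
    unfolding C_def by (simp add: algebra_simps)
  moreover have "n - Suc i = d"
    by (simp add: n)
  ultimately have 2: "sum_coeff n (Suc i)
      = E * ((3 * of_nat n + 3 + of_nat i) * A) / (B * ((2 * of_nat i + 3) * (2 * of_nat i + 2) * C))"
    unfolding sum_coeff_def B_def E_def by simp
  have "(of_nat d + 1 :: rat) > 0" "(2 * of_nat i + 3 :: rat) > 0" "(2 * of_nat i + 2 :: rat) > 0"
    by (simp_all add: add_nonneg_pos)
  then have nz: "(of_nat d + 1 :: rat) \<noteq> 0" "(2 * of_nat i + 3 :: rat) \<noteq> 0" "(2 * of_nat i + 2 :: rat) \<noteq> 0"
    by simp_all
  define x y where "x = (2 * of_nat i + 3 :: rat)" and "y = (2 * of_nat i + 2 :: rat)"
  have xy: "(of_nat i + 1) * (4 * of_nat i + 6) = x * y"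
    by (simp add: x_def y_def algebra_simps)
  show ?thesis
    unfolding 1 2 d xy using nz pos unfolding x_def[symmetric] y_def[symmetric] by simp
qed

text \<open>The shape of the hypergeometric equation both in the variable \<open>z\<close> and in \<open>c = - 4 - z\<close>: the leading
coefficient \<open>z (4 + z)\<close> is invariant under the substitution.\<close>

lemma coeff_second_order:
  fixes p :: "rat poly"
  shows "coeff ([:0, 4, 1:] * pderiv (pderiv p) + [:b, d:] * pderiv p - [:e:] * p) m
    = (of_nat m + 1) * (4 * of_nat m + b) * coeff p (Suc m)
      - (e - d * of_nat m - of_nat m * (of_nat m - 1)) * coeff p m"
proof -
  consider "m = 0" | "m = Suc 0" | k where "m = Suc (Suc k)"
    using not0_implies_Suc by blast
  then show ?thesis
    by cases (simp_all add: coeff_pderiv coeff_pCons algebra_simps)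
qed

text \<open>The proof substitutes \<open>z = - 4 - c\<close> in the hypergeometric equation of the left-hand side. The coefficients of
both sides in powers of \<open>c\<close> then satisfy the same two-term recurrence, which is run downwards from \<open>c^n\<close>.\<close>

lemma sum_coeff_shift:
  "(\<Sum>i\<le>n. sum_coeff n i * (- 4 - c) ^ i) = (- 1) ^ n * sum_coeff n n * (\<Sum>k\<le>n. c ^ k * psi n (n - k))"
proof -
  define T where "T = (\<Sum>i\<le>n. monom (sum_coeff n i) i)"
  have coeff_T: "coeff T i = (if i \<le> n then sum_coeff n i else 0)" for i
    by (simp add: T_def coeff_sum)
  have t_n: "sum_coeff n n \<noteq> 0"
    by (simp add: sum_coeff_def)
  have deg: "degree T = n"
    by (rule antisym[OF degree_le le_degree]) (simp_all add: coeff_T t_n)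
  define L where "L = [:- 4, - 1 :: rat:]"
  define Q where "Q = pcompose T L"
  have T_ode: "[:0, 4, 1:] * pderiv (pderiv T) + [:6, 2 * of_nat n + 4:] * pderiv T - [:3 * of_nat n * (of_nat n + 1):] * T = 0"
  proof (rule poly_eqI)
    fix m
    have "(of_nat m + 1) * (4 * of_nat m + 6) * coeff T (Suc m)
      = (3 * of_nat n * (of_nat n + 1) - (2 * of_nat n + 4) * of_nat m - of_nat m * (of_nat m - 1)) * coeff T m"
      using sum_coeff_Suc[of m n] by (cases "m < n"; cases "m = n") (auto simp: coeff_T algebra_simps)
    then show "coeff ([:0, 4, 1:] * pderiv (pderiv T) + [:6, 2 * of_nat n + 4:] * pderiv T
        - [:3 * of_nat n * (of_nat n + 1):] * T) m = coeff 0 m"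
      unfolding coeff_second_order by simp
  qed
  have Q': "pderiv Q = - pcompose (pderiv T) L"
    by (simp add: Q_def pderiv_pcompose L_def pderiv_pCons)
  have Q'': "pderiv (pderiv Q) = pcompose (pderiv (pderiv T)) L"
    unfolding Q' by (simp add: pderiv_minus pderiv_pcompose L_def pderiv_pCons)
  have L1: "pcompose [:0, 4, 1:] L = [:0, 4, 1:]"
    by (simp add: L_def pcompose_pCons)
  have L2: "pcompose [:6, 2 * of_nat n + 4:] L = - [:8 * of_nat n + 10, 2 * of_nat n + 4:]"
    by (simp add: L_def pcompose_pCons algebra_simps)
  have L3: "pcompose [:e:] L = [:e:]" for e
    by simp
  have "[:0, 4, 1:] * pderiv (pderiv Q) + [:8 * of_nat n + 10, 2 * of_nat n + 4:] * pderiv Q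
      - [:3 * of_nat n * (of_nat n + 1):] * Q = 0"
  proof -
    from T_ode have "pcompose ([:0, 4, 1:] * pderiv (pderiv T) + [:6, 2 * of_nat n + 4:] * pderiv T
        - [:3 * of_nat n * (of_nat n + 1):] * T) L = 0"
      by (simp only: pcompose_0)
    then show ?thesis
      unfolding pcompose_diff pcompose_add pcompose_mult L1 L2 L3 Q''
      unfolding Q' Q_def[symmetric] by (simp only: mult_minus_left mult_minus_right)
  qed
  then have Q_rec: "(of_nat m + 1) * (4 * of_nat m + (8 * of_nat n + 10)) * coeff Q (Suc m)
      = (3 * of_nat n * (of_nat n + 1) - (2 * of_nat n + 4) * of_nat m - of_nat m * (of_nat m - 1)) * coeff Q m" for m
    using coeff_second_order[of Q "8 * of_nat n + 10" "2 * of_nat n + 4" "3 * of_nat n * (of_nat n + 1)" m]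
    by simp
  have degQ: "degree Q = n"
    by (simp add: Q_def degree_pcompose L_def deg)
  have Q_n: "coeff Q n = (- 1) ^ n * sum_coeff n n"
    using lead_coeff_comp[of L T] by (simp add: L_def Q_def[symmetric, unfolded L_def] degQ deg coeff_T)
  have Q_psi: "coeff Q (n - d) = coeff Q n * psi n d" if "d \<le> n" for d
    using that
  proof (induction d)
    case (Suc d)
    define m where "m = n - Suc d"
    have m: "Suc m = n - d" "of_nat m = (of_nat n - of_nat d - 1 :: rat)"
      using Suc.prems by (auto simp: m_def of_nat_diff)
    define u where "u = (of_nat d + 1) * (4 * of_nat n + 2 - of_nat d :: rat)"
    have "u \<noteq> 0"
    proof -
      have "of_nat d < (of_nat n :: rat)" "(of_nat d :: rat) \<ge> 0"
        using Suc.prems by simp_all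
      then have "of_nat d + 1 > (0 :: rat)" "4 * of_nat n + 2 - of_nat d > (0 :: rat)"
        by linarith+
      then show ?thesis
        by (simp add: u_def)
    qed
    have "u * coeff Q m = (of_nat n - of_nat d) * (12 * of_nat n + 6 - 4 * of_nat d) * coeff Q (Suc m)"
      using Q_rec[of m] unfolding m(2) u_def by (simp add: algebra_simps)
    also have "\<dots> = coeff Q n * ((of_nat n - of_nat d) * (12 * of_nat n + 6 - 4 * of_nat d) * psi n d)"
      using Suc by (simp add: m(1) mult_ac)
    also have "\<dots> = u * (coeff Q n * psi n (Suc d))"
      unfolding psi_Suc[symmetric] u_def by (simp only: mult_ac)
    finally show ?case
      using \<open>u \<noteq> 0\<close> by (simp add: m_def)
  qed simp
  have "(\<Sum>i\<le>n. sum_coeff n i * (- 4 - c) ^ i) = poly T (poly L c)"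
    unfolding poly_altdef[of T] deg by (simp add: coeff_T L_def)
  also have "\<dots> = poly Q c"
    by (simp add: Q_def poly_pcompose)
  also have "\<dots> = (\<Sum>k\<le>n. coeff Q n * psi n (n - k) * c ^ k)"
    unfolding poly_altdef[of Q] degQ
  proof (intro sum.cong refl)
    fix k
    assume "k \<in> {..n}"
    then show "coeff Q k * c ^ k = coeff Q n * psi n (n - k) * c ^ k"
      using Q_psi[of "n - k"] by simp
  qed
  finally show ?thesis
    unfolding Q_n by (simp add: sum_distrib_left mult_ac)
qed

section \<open>Product evaluation and conclusion\<close>

lemma prod_falling:
  "d \<le> k \<Longrightarrow> (\<Prod>i<d. of_nat k - of_nat i) * fact (k - d) = (fact k :: rat)"
proof (induction d)
  case (Suc d)
  then have "k - d = Suc (k - Suc d)"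
    by simp
  then have "fact (k - d) = (of_nat k - of_nat d) * (fact (k - Suc d) :: rat)"
    using Suc.prems by (simp add: of_nat_diff)
  with Suc show ?case
    by (simp add: mult_ac)
qed simp

lemma prod_odd_falling:
  "d \<le> k \<Longrightarrow> (\<Prod>i<d. 2 * of_nat k + 1 - 2 * of_nat i) * 2 ^ d * fact (2 * k + 1 - 2 * d) * fact k
     = (fact (2 * k + 1) * fact (k - d) :: rat)"
proof (induction d)
  case (Suc d)
  then obtain e where k: "k = d + Suc e"
    using less_imp_Suc_add[of d k] by auto
  have IH: "(\<Prod>i<d. 2 * of_nat k + 1 - 2 * of_nat i) * 2 ^ d * fact (2 * e + 3) * fact k
     = (fact (2 * k + 1) * fact (Suc e) :: rat)"
  proof -
    have "2 * k + 1 - 2 * d = 2 * e + 3" "k - d = Suc e" "d \<le> k"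
      by (simp_all add: k)
    then show ?thesis
      using Suc.IH by (simp only:)
  qed
  define P where "P = (\<Prod>i<d. 2 * of_nat k + 1 - 2 * of_nat i :: rat)"
  have f3: "fact (2 * e + 3) = (2 * of_nat e + 3) * (2 * (of_nat e + 1)) * (fact (2 * e + 1) :: rat)"
    by (simp add: eval_nat_numeral algebra_simps)
  have "(of_nat e + 1 :: rat) > 0"
    by (simp add: add_nonneg_pos)
  then have nz: "(of_nat e + 1 :: rat) \<noteq> 0"
    by simp
  have "(of_nat e + 1) * (P * (2 * of_nat e + 3) * 2 ^ Suc d * fact (2 * e + 1) * fact k)
     = (of_nat e + 1) * (fact (2 * k + 1) * fact e)"
    using IH unfolding f3 P_def[symmetric] by (simp add: algebra_simps)
  then have "P * (2 * of_nat e + 3) * 2 ^ Suc d * fact (2 * e + 1) * fact k = fact (2 * k + 1) * fact e"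
    using nz by simp
  moreover have "(2 * of_nat k + 1 - 2 * of_nat d :: rat) = 2 * of_nat e + 3"
    by (simp add: k)
  moreover have "2 * k + 1 - 2 * Suc d = 2 * e + 1" "k - Suc d = e"
    by (simp_all add: k)
  ultimately show ?case
    by (simp only: prod.lessThan_Suc P_def)
qed simp

lemma psi_diag: "psi n n = fact (6 * n + 3) * fact (2 * n + 1) * (3 * of_nat n + 2) / (fact (4 * n + 3) * fact (4 * n + 2))"
proof -
  define A where "A = (\<Prod>i<n. 2 * of_nat (3 * n + 1) + 1 - 2 * of_nat i :: rat)"
  define B where "B = (\<Prod>i<n. of_nat (4 * n + 2) - of_nat i :: rat)"
  have A: "A * 2 ^ n * fact (4 * n + 3) * fact (3 * n + 1) = fact (6 * n + 3) * fact (2 * n + 1)"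
  proof -
    have "2 * (3 * n + 1) + 1 = 6 * n + 3" "6 * n + 3 - 2 * n = 4 * n + 3" "3 * n + 1 - n = 2 * n + 1"
      "n \<le> 3 * n + 1"
      by simp_all
    then show ?thesis
      using prod_odd_falling[of n "3 * n + 1"] unfolding A_def by (simp only:)
  qed
  have B: "B * fact (3 * n + 2) = fact (4 * n + 2)"
    using prod_falling[of n "4 * n + 2"] by (simp add: B_def)
  define C where "C = (\<Prod>i<n. 3 * of_nat n + 3 / 2 - of_nat i :: rat)"
  have "A = (\<Prod>i<n. 2 * (3 * of_nat n + 3 / 2 - of_nat i))"
    unfolding A_def by (intro prod.cong) (simp_all add: algebra_simps)
  then have "A = 2 ^ n * C"
    by (simp only: prod.distrib C_def prod_constant card_lessThan)
  moreover have "psi n n = 4 ^ n * C / B"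
    by (simp add: psi_def B_def C_def add.commute)
  moreover have "(4 :: rat) ^ n = 2 ^ n * 2 ^ n"
    by (simp flip: power_mult_distrib)
  ultimately have "psi n n = 2 ^ n * A / B"
    by simp
  also have "\<dots> = fact (6 * n + 3) * fact (2 * n + 1) * (3 * of_nat n + 2) / (fact (4 * n + 3) * fact (4 * n + 2))"
  proof -
    define x y z where "x = (3 * of_nat n + 2 :: rat)" and "y = (fact (3 * n + 1) :: rat)"
      and "z = (fact (4 * n + 3) :: rat)"
    have "fact (3 * n + 2) = x * y"
      by (simp add: eval_nat_numeral algebra_simps x_def y_def)
    then have B': "B * (x * y) = fact (4 * n + 2)"
      using B by simp
    then have "B \<noteq> 0" "x \<noteq> 0" "y \<noteq> 0" "z \<noteq> 0"
      by (auto simp: z_def)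
    then show ?thesis
      unfolding A[symmetric] B'[symmetric] x_def[symmetric] y_def[symmetric] z_def[symmetric] by simp
  qed
  finally show ?thesis .
qed

text \<open>The factor with index \<open>i\<close> of the product in the theorem; only \<open>i \<ge> 1\<close> is meaningful.\<close>

definition prod_factor :: "nat \<Rightarrow> rat" where
  "prod_factor i = (fact (6 * i - 3) * fact (3 * i + 2) * fact (2 * i - 1)) /
                 (fact (4 * i - 1) * fact (4 * i + 1) * fact (3 * i - 2))"

text \<open>The ratio of successive determinants \<open>D\<^sub>n(0)\<close> is \<open>psi n n\<close>; this identity is the induction step of
\<open>det_kernel_0\<close>.\<close>

lemma psi_diag_sum_coeff: "psi n n * sum_coeff n n = prod_factor (Suc n) * sum_coeff (Suc n) (Suc n)"
proof -
  have idx: "6 * Suc n - 3 = 6 * n + 3" "3 * Suc n + 2 = 3 * n + 5" "2 * Suc n - 1 = 2 * n + 1"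
    "4 * Suc n - 1 = 4 * n + 3" "4 * Suc n + 1 = 4 * n + 5" "3 * Suc n - 2 = 3 * n + 1"
    "3 * Suc n + Suc n + 2 = 4 * n + 6" "2 * Suc n + 1 = 2 * n + 3" "3 * n + n + 2 = 4 * n + 2"
    by simp_all
  have f: "fact (3 * n + 2) = (3 * of_nat n + 2) * (fact (3 * n + 1) :: rat)"
    "fact (4 * n + 6) = (4 * of_nat n + 6) * (fact (4 * n + 5) :: rat)"
    "fact (Suc n) = (of_nat n + 1) * (fact n :: rat)"
    "fact (2 * n + 3) = (2 * of_nat n + 3) * (2 * of_nat n + 2) * (fact (2 * n + 1) :: rat)"
    by (simp_all add: eval_nat_numeral algebra_simps)
  have "(3 * of_nat n + 2 :: rat) > 0" "(2 * of_nat n + 3 :: rat) > 0" "(2 * of_nat n + 2 :: rat) > 0"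
    by (simp_all add: add_nonneg_pos)
  then have nz: "(3 * of_nat n + 2 :: rat) \<noteq> 0" "(2 * of_nat n + 3 :: rat) \<noteq> 0" "(2 * of_nat n + 2 :: rat) \<noteq> 0"
    by simp_all
  define x y z where "x = (3 * of_nat n + 2 :: rat)" and "y = (2 * of_nat n + 3 :: rat)" and "z = (2 * of_nat n + 2 :: rat)"
  have yz: "4 * of_nat n + 6 = 2 * y" "of_nat n + 1 = z / 2"
    by (simp_all add: y_def z_def)
  show ?thesis
    unfolding psi_diag sum_coeff_def prod_factor_def idx f diff_self_eq_0 fact_0
    using nz unfolding x_def[symmetric] y_def[symmetric] z_def[symmetric] yz
    by simp
qed

lemma det_kernel_Suc:
  "det (mat (n + 1) (n + 1) (\<lambda>(i, j). kernel_col c j $ i))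
     = det (mat n n (\<lambda>(i, j). kernel_col 0 j $ i)) * (\<Sum>k\<le>n. c ^ k * psi n (n - k))"
proof -
  obtain w where w: "w n = 1" "\<And>j. j \<le> 2 * n \<Longrightarrow> (\<Sum>m\<le>n. w m * kernel_col 0 j $ m) = psi n (2 * n - j)"
    using exists_kernel_functional[of n] by blast
  have "(\<Sum>m\<le>n. w m * kernel_col 0 j $ m) = 0" if "j < n" for j
    using that by (simp add: w psi_eq_0)
  from det_kernel_functional[OF w(1) this] show ?thesis
    by (simp add: w)
qed

lemma det_kernel_0:
  "det (mat n n (\<lambda>(i, j). kernel_col 0 j $ i)) = (\<Prod>i=1..n. prod_factor i) * sum_coeff n n"
proof (induction n)
  case 0
  show ?case by (simp add: sum_coeff_def)
next
  case (Suc n)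
  have "(\<Sum>k\<le>n. 0 ^ k * psi n (n - k)) = psi n n"
    by (simp add: power_0_left if_distrib[of "\<lambda>x. x * _"] cong: if_cong)
  then show ?case
    using det_kernel_Suc[of n 0] Suc psi_diag_sum_coeff[of n] by (simp add: mult_ac)
qed

lemma det_kernel:
  "det (mat (n + 1) (n + 1) (\<lambda>(i, j). kernel_col c j $ i))
     = (- 1) ^ n * (\<Prod>i=1..n. prod_factor i) * (\<Sum>i\<le>n. sum_coeff n i * (- 4 - c) ^ i)"
  unfolding sum_coeff_shift det_kernel_Suc det_kernel_0 by (simp add: mult_ac flip: power_mult_distrib)

theorem corollary4:
  fixes n :: nat
  shows "det (mat (n + 1) (n + 1) (\<lambda>(i, j). of_nat ((3 * (i + j) + 1) choose (i + j)) :: rat)) =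
      (-1) ^ n *
      (\<Prod>i = 1..n. (fact (6 * i - 3) * fact (3 * i + 2) * fact (2 * i - 1)) /
                 (fact (4 * i - 1) * fact (4 * i + 1) * fact (3 * i - 2))) *
      (\<Sum>i = 0..n. (fact n * fact (3 * n + i + 2) * (-6) ^ i) /
                 (fact (3 * n + 2) * fact (n - i) * fact (2 * i + 1)))
    \<and> det (mat (n + 1) (n + 1) (\<lambda>(i, j). of_nat ((3 * (i + j) + 2) choose (i + j)) :: rat)) =
      (-1) ^ n *
      (\<Prod>i = 1..n. (fact (6 * i - 3) * fact (3 * i + 2) * fact (2 * i - 1)) /
                 (fact (4 * i - 1) * fact (4 * i + 1) * fact (3 * i - 2))) *
      (\<Sum>i = 0..n. (fact n * fact (3 * n + i + 2) * (-4) ^ i) /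
                 (fact (3 * n + 2) * fact (n - i) * fact (2 * i + 1)))"
proof -
  have sums: "(\<Sum>i\<le>n. sum_coeff n i * z ^ i) = (\<Sum>i = 0..n. (fact n * fact (3 * n + i + 2) * z ^ i) /
                 (fact (3 * n + 2) * fact (n - i) * fact (2 * i + 1)))" for z
    by (simp add: sum_coeff_def atLeast0AtMost)
  have "det (mat (n + 1) (n + 1) (\<lambda>(i, j). of_nat ((3 * (i + j) + 1) choose (i + j)) :: rat))
      = (- 1) ^ n * (\<Prod>i=1..n. prod_factor i) * (\<Sum>i\<le>n. sum_coeff n i * (- 4 - 2) ^ i)"
    by (rule trans[OF det_hankel_eq_det_kernel det_kernel]) simp
  moreover have "det (mat (n + 1) (n + 1) (\<lambda>(i, j). of_nat ((3 * (i + j) + 2) choose (i + j)) :: rat))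
      = (- 1) ^ n * (\<Prod>i=1..n. prod_factor i) * (\<Sum>i\<le>n. sum_coeff n i * (- 4 - 0) ^ i)"
    by (rule trans[OF det_hankel_eq_det_kernel det_kernel]) simp
  ultimately show ?thesis
    unfolding sums prod_factor_def by simp
qed

end
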